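(* Let $k,n$ be positive integers. Then \[ \overline{s}_{(k)}(x_1,\dots,x_n)=\sum_{\substack{|\mu|=k\\ \ell(\mu)<n}} f^{\mu+(1^{n-1})}\,s_\mu(x_1,\dots,x_n), \] where the sum is over partitions $\mu$ of $k$ with fewer than $n$ parts.
   Context: $\overline{s}_\lambda(x_1,\dots,x_n):=s_\lambda(p-x_1,\dots,p-x_n)$ with $p=x_1+\dots+x_n$, where $s_\lambda$ is the Schur polynomial in $n$ variables; $(k)$ is the one-row partition. $\ell(\mu)$ is the number of nonzero parts of $\mu$. For a partition $\mu=(\mu_1,\mu_2,\dots)$ (padded with zeros), $\mu+(1^{n-1})$ is the partition $(\mu_1+1,\dots,\mu_{n-1}+1,\mu_n,\dots)$. $f^{\alpha}$ is the number of standard Young tableaux of shape $\alpha$. *)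

theory Defs
  imports
    Main
    "HOL-Library.FuncSet"
    "HOL-Library.Poly_Mapping"
begin

subsection \<open>Partitions\<close>

text \<open>A partition is the weakly decreasing, finitely supported sequence of its parts,
  padded with zeros. Rows and columns are numbered from zero, so \<open>\<mu> 0\<close> is the largest part.\<close>

definition is_partition :: "(nat \<Rightarrow> nat) \<Rightarrow> bool" where
  "is_partition \<mu> \<longleftrightarrow> antimono \<mu> \<and> finite {i. \<mu> i \<noteq> 0}"

definition psize :: "(nat \<Rightarrow> nat) \<Rightarrow> nat" where
  "psize \<mu> = (\<Sum>i | \<mu> i \<noteq> 0. \<mu> i)"

definition plen :: "(nat \<Rightarrow> nat) \<Rightarrow> nat" where
  "plen \<mu> = card {i. \<mu> i \<noteq> 0}"

definition one_row :: "nat \<Rightarrow> nat \<Rightarrow> nat" where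
  "one_row k = (\<lambda>i. if i = 0 then k else 0)"

definition one_column :: "nat \<Rightarrow> nat \<Rightarrow> nat" where
  "one_column m = (\<lambda>i. if i < m then 1 else 0)"

definition young_diagram :: "(nat \<Rightarrow> nat) \<Rightarrow> (nat \<times> nat) set" where
  "young_diagram \<mu> = {(i, j). j < \<mu> i}"

subsection \<open>Tableaux\<close>

text \<open>Fillings are extensional functions (\<open>undefined\<close> outside the diagram), so that distinct
  functions are distinct tableaux.\<close>

definition semistandard_tableaux :: "nat \<Rightarrow> (nat \<Rightarrow> nat) \<Rightarrow> (nat \<times> nat \<Rightarrow> nat) set" where
  "semistandard_tableaux n \<mu> = {T \<in> young_diagram \<mu> \<rightarrow>\<^sub>E {1..n}.
     (\<forall>i j j'. j < j' \<and> (i, j') \<in> young_diagram \<mu> \<longrightarrow> T (i, j) \<le> T (i, j')) \<and>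
     (\<forall>i i' j. i < i' \<and> (i', j) \<in> young_diagram \<mu> \<longrightarrow> T (i, j) < T (i', j))}"

definition standard_tableaux :: "(nat \<Rightarrow> nat) \<Rightarrow> (nat \<times> nat \<Rightarrow> nat) set" where
  "standard_tableaux \<mu> = {T \<in> young_diagram \<mu> \<rightarrow>\<^sub>E {1..psize \<mu>}.
     bij_betw T (young_diagram \<mu>) {1..psize \<mu>} \<and>
     (\<forall>i j j'. j < j' \<and> (i, j') \<in> young_diagram \<mu> \<longrightarrow> T (i, j) < T (i, j')) \<and>
     (\<forall>i i' j. i < i' \<and> (i', j) \<in> young_diagram \<mu> \<longrightarrow> T (i, j) < T (i', j))}"

definition num_SYT :: "(nat \<Rightarrow> nat) \<Rightarrow> nat" where
  "num_SYT \<mu> = card (standard_tableaux \<mu>)"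

subsection \<open>Schur polynomials\<close>

text \<open>\<open>schur n \<mu> y\<close> is \<open>s\<^sub>\<mu>(y\<^sub>1, \<dots>, y\<^sub>n)\<close> for elements \<open>y\<^sub>1, \<dots>, y\<^sub>n\<close> of any commutative ring; the
  values of \<open>y\<close> outside \<open>{1..n}\<close> are irrelevant. The Schur polynomial itself is obtained by
  taking \<open>y\<close> to be the indeterminates \<open>indet\<close> below.\<close>

definition schur :: "nat \<Rightarrow> (nat \<Rightarrow> nat) \<Rightarrow> (nat \<Rightarrow> 'b) \<Rightarrow> 'b::comm_ring_1" where
  "schur n \<mu> y = (\<Sum>T\<in>semistandard_tableaux n \<mu>. \<Prod>c\<in>young_diagram \<mu>. y (T c))"

definition schur_bar :: "nat \<Rightarrow> (nat \<Rightarrow> nat) \<Rightarrow> (nat \<Rightarrow> 'b) \<Rightarrow> 'b::comm_ring_1" where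
  "schur_bar n \<mu> x = schur n \<mu> (\<lambda>i. (\<Sum>j = 1..n. x j) - x i)"

text \<open>Polynomials in indeterminates indexed by \<open>nat\<close>: finitely supported maps from monomials
  (exponent vectors) to coefficients, with the convolution product of \<open>Poly_Mapping\<close>.\<close>

type_synonym 'a mpoly = "(nat \<Rightarrow>\<^sub>0 nat) \<Rightarrow>\<^sub>0 'a"

definition indet :: "nat \<Rightarrow> 'a::comm_ring_1 mpoly" where
  "indet i = Poly_Mapping.single (Poly_Mapping.single i 1) 1"

subsection \<open>All index sets are finite\<close>

lemma finite_young_diagram:
  assumes "is_partition \<mu>"
  shows "finite (young_diagram \<mu>)"
proof -
  have "young_diagram \<mu> = Sigma {i. \<mu> i \<noteq> 0} (\<lambda>i. {..<\<mu> i})"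
    by (auto simp: young_diagram_def)
  then show ?thesis using assms by (simp add: is_partition_def)
qed

lemma finite_semistandard_tableaux:
  assumes "is_partition \<mu>"
  shows "finite (semistandard_tableaux n \<mu>)"
  by (rule finite_subset[of _ "young_diagram \<mu> \<rightarrow>\<^sub>E {1..n}"])
     (auto simp: semistandard_tableaux_def intro: finite_PiE finite_young_diagram[OF assms])

lemma finite_standard_tableaux:
  assumes "is_partition \<mu>"
  shows "finite (standard_tableaux \<mu>)"
  by (rule finite_subset[of _ "young_diagram \<mu> \<rightarrow>\<^sub>E {1..psize \<mu>}"])
     (auto simp: standard_tableaux_def intro: finite_PiE finite_young_diagram[OF assms])

lemma partition_zero_beyond_plen:
  assumes "is_partition \<mu>" "plen \<mu> \<le> i"
  shows "\<mu> i = 0"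
proof (rule ccontr)
  assume "\<mu> i \<noteq> 0"
  then have "{..i} \<subseteq> {i. \<mu> i \<noteq> 0}"
    using assms(1) by (auto simp: is_partition_def antimono_def) (metis le_zero_eq neq0_conv)
  then have "card {..i} \<le> plen \<mu>"
    using assms(1) unfolding plen_def is_partition_def by (intro card_mono) auto
  then show False using assms(2) by simp
qed

lemma finite_partitions: "finite {\<mu>. is_partition \<mu> \<and> psize \<mu> = k \<and> plen \<mu> < n}"
proof (rule finite_subset)
  show "{\<mu>. is_partition \<mu> \<and> psize \<mu> = k \<and> plen \<mu> < n} \<subseteq>
      {\<mu>. \<forall>i. (i \<in> {..<n} \<longrightarrow> \<mu> i \<in> {..k}) \<and> (i \<notin> {..<n} \<longrightarrow> \<mu> i = 0)}"
  proof clarify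
    fix \<mu> :: "nat \<Rightarrow> nat" and i
    assume *: "is_partition \<mu>" "plen \<mu> < n" "k = psize \<mu>"
    have "\<mu> i \<le> psize \<mu>" if "\<mu> i \<noteq> 0"
      unfolding psize_def using * that
      by (intro member_le_sum) (auto simp: is_partition_def)
    then have "\<mu> i \<le> psize \<mu>" by (cases "\<mu> i = 0") auto
    moreover have "\<mu> i = 0" if "\<not> i < n"
      using * that by (intro partition_zero_beyond_plen) auto
    ultimately show "(i \<in> {..<n} \<longrightarrow> \<mu> i \<in> {..psize \<mu>}) \<and> (i \<notin> {..<n} \<longrightarrow> \<mu> i = 0)"
      by auto
  qed
qed (rule finite_set_of_finite_funs; simp)

end

theory Submission
  imports Defs "HOL-Combinatorics.Permutations"
begin

text \<open>
  With \<open>p = x\<^sub>1 + \<dots> + x\<^sub>n\<close>, expanding a complete homogeneous polynomial at shifted arguments gives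
  \<open>h\<^sub>k(p - x\<^sub>1, \<dots>, p - x\<^sub>n) = \<Sum>\<^sub>r (-1)\<^sup>r binom(k + n - 1, k - r) p\<^bsup>k-r\<^esup> h\<^sub>r(x)\<close>. By Pieri's rule for a single box,
  the coefficient of \<open>s\<^sub>\<mu>\<close> in \<open>p\<^bsup>k-r\<^esup> h\<^sub>r\<close> is that of \<open>x\<^bsup>\<mu>+\<delta>\<^esup>\<close> in \<open>p\<^bsup>k-r\<^esup> a\<^bsub>(r)+\<delta>\<^esub>\<close>, where \<open>a\<close> denotes
  alternants: both obey the same recursion over the corners of \<open>\<mu>\<close>. Up to sign, \<open>a\<^bsub>(r)+\<delta>\<^esub>\<close> is the
  alternant with exponents \<open>(n-2, \<dots>, 0, r+n-1)\<close>, and the alternant with exponents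
  \<open>(n-2, \<dots>, 0, s)\<close> vanishes for \<open>s < n-1\<close>. The alternating sum over \<open>r\<close> is therefore a complete
  binomial expansion, equal to the sum over permutations \<open>\<sigma>\<close> of
  \<open>sign \<sigma> (p - x\<^bsub>\<sigma>(n)\<^esub>)\<^bsup>k+n-1\<^esup> \<Prod>\<^bsub>i<n\<^esub> x\<^bsub>\<sigma>(i)\<^esub>\<^bsup>n-1-i\<^esup>\<close>. The term of \<open>\<sigma>\<close> does not contain the variable
  \<open>x\<^bsub>\<sigma>(n)\<^esub>\<close>, whereas \<open>x\<^bsup>\<mu>+\<delta>\<^esup>\<close> contains \<open>x\<^sub>1, \<dots>, x\<^bsub>n-1\<^esub>\<close>; so its coefficient vanishes unless \<open>\<mu>\<^sub>n = 0\<close>,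
  and in that case only the \<open>\<sigma>\<close> fixing \<open>n\<close> survive and leave the Frobenius expression of \<open>f\<close> in
  \<open>n - 1\<close> variables.
\<close>

subsection \<open>Partitions and horizontal strips\<close>

lemma psize_eq_sum:
  assumes "\<And>i. i \<ge> M \<Longrightarrow> \<mu> i = 0"
  shows "psize \<mu> = (\<Sum>i<M. \<mu> i)"
  unfolding psize_def
proof (rule sum.mono_neutral_left)
  show "{i. \<mu> i \<noteq> 0} \<subseteq> {..<M}"
    by (rule subsetI, rule ccontr) (simp add: assms)
qed auto

lemma partition_supp:
  assumes "is_partition \<mu>"
  obtains M where "\<And>i. i \<ge> M \<Longrightarrow> \<mu> i = 0"
  using partition_zero_beyond_plen[OF assms] by blast

lemma partition_Suc_le: "is_partition \<mu> \<Longrightarrow> \<mu> (Suc i) \<le> \<mu> i"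
  by (auto simp: is_partition_def antimono_def)

lemma partition_antimono: "is_partition \<mu> \<Longrightarrow> i \<le> j \<Longrightarrow> \<mu> j \<le> \<mu> i"
  by (auto simp: is_partition_def antimono_def)

lemma is_partitionI:
  assumes "\<And>i. \<mu> (Suc i) \<le> \<mu> i" and "\<And>i. i \<ge> M \<Longrightarrow> \<mu> i = 0"
  shows "is_partition \<mu>"
proof -
  have "{i. \<mu> i \<noteq> 0} \<subseteq> {..<M}"
    by (rule subsetI, rule ccontr) (simp add: assms(2))
  then show ?thesis
    using assms(1) by (auto simp: is_partition_def antimono_iff_le_Suc intro: finite_subset)
qed

lemma plen_le_iff:
  assumes "is_partition \<mu>"
  shows "plen \<mu> \<le> n \<longleftrightarrow> (\<forall>i\<ge>n. \<mu> i = 0)"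
proof
  assume "plen \<mu> \<le> n"
  then show "\<forall>i\<ge>n. \<mu> i = 0"
    using partition_zero_beyond_plen[OF assms] by auto
next
  assume *: "\<forall>i\<ge>n. \<mu> i = 0"
  have "{i. \<mu> i \<noteq> 0} \<subseteq> {..<n}"
    by (rule subsetI, rule ccontr) (simp add: *)
  then have "card {i. \<mu> i \<noteq> 0} \<le> card {..<n}"
    by (rule card_mono[rotated]) simp
  then show "plen \<mu> \<le> n"
    by (simp add: plen_def)
qed

lemma card_young_diagram:
  assumes "is_partition \<mu>"
  shows "card (young_diagram \<mu>) = psize \<mu>"
proof -
  have "young_diagram \<mu> = Sigma {i. \<mu> i \<noteq> 0} (\<lambda>i. {..<\<mu> i})"
    by (auto simp: young_diagram_def)
  then show ?thesis
    using assms by (simp add: psize_def is_partition_def)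
qed

lemma psize_add_box:
  assumes "is_partition \<mu>"
  shows "psize (\<mu>(i := Suc (\<mu> i))) = Suc (psize \<mu>)"
proof -
  obtain M where M: "\<And>i. i \<ge> M \<Longrightarrow> \<mu> i = 0"
    using partition_supp[OF assms] by blast
  define L where "L = max M (Suc i)"
  have "psize (\<mu>(i := Suc (\<mu> i))) = (\<Sum>j<L. (\<mu>(i := Suc (\<mu> i))) j)"
    using M by (intro psize_eq_sum) (auto simp: L_def)
  also have "\<dots> = (\<Sum>j<L. \<mu> j + (if j = i then 1 else 0))"
    by (intro sum.cong) auto
  also have "\<dots> = Suc (\<Sum>j<L. \<mu> j)"
    by (simp add: sum.distrib L_def)
  also have "(\<Sum>j<L. \<mu> j) = psize \<mu>"
    using M by (intro psize_eq_sum[symmetric]) (auto simp: L_def)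
  finally show ?thesis .
qed

lemma psize_eq_0_iff:
  assumes "is_partition \<mu>"
  shows "psize \<mu> = 0 \<longleftrightarrow> \<mu> = (\<lambda>_. 0)"
  using assms by (auto simp: psize_def is_partition_def fun_eq_iff)

text \<open>Interlacing of parts: \<nu> lies inside \<mu> and the skew shape \<mu>/\<nu> has at most
  one box in each column. These are the shapes left when all copies of the largest letter are
  removed from a semistandard tableau of shape \<mu>.\<close>

definition strip :: "(nat \<Rightarrow> nat) \<Rightarrow> (nat \<Rightarrow> nat) \<Rightarrow> bool" where
  "strip \<mu> \<nu> \<longleftrightarrow> (\<forall>i. \<nu> i \<le> \<mu> i \<and> \<mu> (Suc i) \<le> \<nu> i)"

lemma stripD:
  assumes "strip \<mu> \<nu>"
  shows "\<nu> i \<le> \<mu> i" and "\<mu> (Suc i) \<le> \<nu> i"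
  using assms by (simp_all add: strip_def)

lemma strip_partition:
  assumes "strip \<mu> \<nu>" "is_partition \<mu>"
  shows "is_partition \<nu>"
proof -
  obtain M where M: "\<And>i. i \<ge> M \<Longrightarrow> \<mu> i = 0"
    using partition_supp[OF assms(2)] by blast
  show ?thesis
  proof (rule is_partitionI)
    show "\<nu> (Suc i) \<le> \<nu> i" for i
      using stripD[OF assms(1)] by (rule le_trans)
    show "\<nu> i = 0" if "i \<ge> M" for i
      using stripD(1)[OF assms(1), of i] M[OF that] by simp
  qed
qed

lemma finite_bounded_funs: "finite {f :: nat \<Rightarrow> nat. (\<forall>i<M. f i \<le> B) \<and> (\<forall>i\<ge>M. f i = 0)}"
proof (rule finite_subset)
  show "{f. (\<forall>i<M. f i \<le> B) \<and> (\<forall>i\<ge>M. f i = 0)} \<subseteq>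
      {f. \<forall>i. (i \<in> {..<M} \<longrightarrow> f i \<in> {..B}) \<and> (i \<notin> {..<M} \<longrightarrow> f i = 0)}"
    by auto
qed (rule finite_set_of_finite_funs; simp)

lemma finite_strip:
  assumes "is_partition \<mu>"
  shows "finite {\<nu>. strip \<mu> \<nu>}"
proof -
  obtain M where M: "\<And>i. i \<ge> M \<Longrightarrow> \<mu> i = 0"
    using partition_supp[OF assms] by blast
  have "\<nu> i \<le> \<mu> 0 \<and> (i \<ge> M \<longrightarrow> \<nu> i = 0)" if "strip \<mu> \<nu>" for \<nu> i
    using stripD(1)[OF that, of i] partition_antimono[OF assms, of 0 i] M[of i] by auto
  then have "{\<nu>. strip \<mu> \<nu>} \<subseteq> {f. (\<forall>i<M. f i \<le> \<mu> 0) \<and> (\<forall>i\<ge>M. f i = 0)}"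
    by blast
  then show ?thesis
    using finite_bounded_funs by (rule finite_subset)
qed

text \<open>The least number outside S bounds it. This turns the initial segment of a row that
  carries small entries into a row length.\<close>

lemma down_closed_eq_lessThan:
  fixes S :: "nat set"
  assumes "finite S" and "\<And>i j. j \<in> S \<Longrightarrow> i < j \<Longrightarrow> i \<in> S"
  shows "S = {..<card S}"
proof -
  have "\<exists>k. k \<notin> S"
    using assms(1) infinite_UNIV_nat by (intro ex_new_if_finite)
  then obtain k where k: "k \<notin> S" "\<And>i. i < k \<Longrightarrow> i \<in> S"
    using LeastI_ex[of "\<lambda>k. k \<notin> S"] not_less_Least[of _ "\<lambda>k. k \<notin> S"] by blast
  then have "S = {..<k}"
    using assms(2) by (auto simp: set_eq_iff) (metis linorder_neqE_nat)
  then show ?thesis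
    by simp
qed

subsection \<open>Branching and Pieri rules for Schur polynomials\<close>

text \<open>The cells with entry \<open>Suc n\<close> end their rows, and strict columns allow at
  most one of them per column, so they form a horizontal strip. Removing them is a bijection onto
  pairs of a strip and a tableau in the letters up to n; every removed cell contributes one factor
  \<open>y (Suc n)\<close>.\<close>

lemma schur_branching:
  assumes part: "is_partition \<mu>"
  shows "schur (Suc n) \<mu> y =
    (\<Sum>\<nu> | strip \<mu> \<nu>. schur n \<nu> y * y (Suc n) ^ (psize \<mu> - psize \<nu>))"
proof -
  let ?Y = young_diagram and ?SS = semistandard_tableaux
  \<comment> \<open>\<open>shape\<close> gives the row lengths of the part with entries at most n,
    and \<open>ext\<close> fills the strip back in with \<open>Suc n\<close>; the two maps are
    mutually inverse.\<close>
  define shape where "shape T = (\<lambda>i. card {j. j < \<mu> i \<and> T (i, j) \<le> n})" for T :: "nat \<times> nat \<Rightarrow> nat"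
  define ext where "ext \<nu> T = (\<lambda>c. if c \<in> ?Y \<nu> then T c else if c \<in> ?Y \<mu> then Suc n else undefined)"
    for \<nu> and T :: "nat \<times> nat \<Rightarrow> nat"
  have sub: "?Y \<nu> \<subseteq> ?Y \<mu>" if "strip \<mu> \<nu>" for \<nu>
    using that by (auto simp: young_diagram_def strip_def intro: less_le_trans)
  have shape_iff: "(i, j) \<in> ?Y (shape T) \<longleftrightarrow> (i, j) \<in> ?Y \<mu> \<and> T (i, j) \<le> n"
    if T: "T \<in> ?SS (Suc n) \<mu>" for T i j
  proof -
    have "{j. j < \<mu> i \<and> T (i, j) \<le> n} = {..<shape T i}"
      unfolding shape_def
    proof (rule down_closed_eq_lessThan)
      fix j j' assume "j' \<in> {j. j < \<mu> i \<and> T (i, j) \<le> n}" "j < j'"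
      then show "j \<in> {j. j < \<mu> i \<and> T (i, j) \<le> n}"
        using T by (auto simp: semistandard_tableaux_def young_diagram_def) (meson le_trans)
    qed auto
    then show ?thesis
      by (auto simp: young_diagram_def)
  qed
  have T_le: "T c \<le> Suc n" if "T \<in> ?SS (Suc n) \<mu>" "c \<in> ?Y \<mu>" for T c
    using that by (auto simp: semistandard_tableaux_def PiE_iff)
  have strip_shape: "strip \<mu> (shape T)" if T: "T \<in> ?SS (Suc n) \<mu>" for T
    unfolding strip_def
  proof (intro allI conjI)
    fix i
    have "card {j. j < \<mu> i \<and> T (i, j) \<le> n} \<le> card {..<\<mu> i}"
      by (rule card_mono) auto
    then show "shape T i \<le> \<mu> i"
      by (simp add: shape_def)
    show "\<mu> (Suc i) \<le> shape T i"
    \<comment> \<open>Otherwise the first cell of row i with entry \<open>Suc n\<close> has a cell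
      below it, whose entry would have to be larger still.\<close>
    proof (rule ccontr)
      assume a: "\<not> \<mu> (Suc i) \<le> shape T i"
      define j where "j = shape T i"
      have j: "(Suc i, j) \<in> ?Y \<mu>" "(i, j) \<in> ?Y \<mu>"
        using a partition_Suc_le[OF part, of i] by (auto simp: young_diagram_def j_def)
      have "T (i, j) < T (Suc i, j)"
        using T j by (auto simp: semistandard_tableaux_def)
      with T_le[OF T j(1)] have "T (i, j) \<le> n"
        by simp
      with shape_iff[OF T] j have "(i, j) \<in> ?Y (shape T)"
        by simp
      then show False
        by (simp add: young_diagram_def j_def)
    qed
  qed
  have ext_eq: "ext (shape T) (restrict T (?Y (shape T))) = T" if T: "T \<in> ?SS (Suc n) \<mu>" for T
  proof
    fix c :: "nat \<times> nat"
    obtain i j where c: "c = (i, j)" by fastforce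
    show "ext (shape T) (restrict T (?Y (shape T))) c = T c"
    proof (cases "c \<in> ?Y \<mu>")
      case True
      then show ?thesis
        using shape_iff[OF T, of i j] T_le[OF T True] c by (auto simp: ext_def le_Suc_eq)
    next
      case False
      have "T \<in> ?Y \<mu> \<rightarrow>\<^sub>E {1..Suc n}"
        using T by (simp add: semistandard_tableaux_def)
      then have "T c = undefined"
        using False by (rule PiE_arb)
      with False show ?thesis
        using shape_iff[OF T, of i j] c by (auto simp: ext_def)
    qed
  qed
  have ext_SS: "ext \<nu> T \<in> ?SS (Suc n) \<mu>" if \<nu>: "strip \<mu> \<nu>" and T: "T \<in> ?SS n \<nu>" for \<nu> T
  proof -
    have range: "T c \<in> {1..n}" if "c \<in> ?Y \<nu>" for c
      using T that by (auto simp: semistandard_tableaux_def PiE_iff)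
    have "ext \<nu> T \<in> ?Y \<mu> \<rightarrow>\<^sub>E {1..Suc n}"
      using range sub[OF \<nu>] by (force simp: ext_def PiE_iff extensional_def)
    moreover have "ext \<nu> T (i, j) \<le> ext \<nu> T (i, j')" if "j < j'" "(i, j') \<in> ?Y \<mu>" for i j j'
    proof (cases "(i, j') \<in> ?Y \<nu>")
      case True
      then have "(i, j) \<in> ?Y \<nu>"
        using that by (auto simp: young_diagram_def)
      with True show ?thesis
        using T that by (auto simp: semistandard_tableaux_def ext_def)
    next
      case False
      have "(i, j) \<in> ?Y \<mu>"
        using that by (auto simp: young_diagram_def)
      then show ?thesis
        using False range[of "(i, j)"] that by (auto simp: ext_def)
    qed
    moreover have "ext \<nu> T (i, j) < ext \<nu> T (i', j)" if "i < i'" "(i', j) \<in> ?Y \<mu>" for i i' j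
    proof -
      have "\<mu> i' \<le> \<mu> (Suc i)"
        using partition_antimono[OF part] that by (simp add: Suc_leI)
      also have "\<dots> \<le> \<nu> i"
        using \<nu> by (simp add: strip_def)
      finally have *: "(i, j) \<in> ?Y \<nu>"
        using that by (auto simp: young_diagram_def)
      show ?thesis
      proof (cases "(i', j) \<in> ?Y \<nu>")
        case True
        then show ?thesis
          using T * that by (auto simp: semistandard_tableaux_def ext_def)
      next
        case False
        then show ?thesis
          using * range[OF *] that by (auto simp: ext_def)
      qed
    qed
    ultimately show ?thesis
      by (auto simp: semistandard_tableaux_def)
  qed
  have shape_ext: "shape (ext \<nu> T) = \<nu>" if \<nu>: "strip \<mu> \<nu>" and T: "T \<in> ?SS n \<nu>" for \<nu> T
  proof
    fix i
    have "ext \<nu> T (i, j) \<le> n \<longleftrightarrow> j < \<nu> i" if "j < \<mu> i" for j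
      using that T by (auto simp: ext_def young_diagram_def semistandard_tableaux_def PiE_iff)
    then have "{j. j < \<mu> i \<and> ext \<nu> T (i, j) \<le> n} = {..<\<nu> i}"
      using \<nu> by (auto simp: strip_def intro: less_le_trans)
    then show "shape (ext \<nu> T) i = \<nu> i"
      by (simp add: shape_def)
  qed
  have restr_SS: "restrict T (?Y (shape T)) \<in> ?SS n (shape T)" if T: "T \<in> ?SS (Suc n) \<mu>" for T
  proof -
    have part': "is_partition (shape T)"
      using strip_partition[OF strip_shape[OF T] part] .
    have "T c \<in> {1..n}" if "c \<in> ?Y (shape T)" for c
      using shape_iff[OF T, of "fst c" "snd c"] that T
      by (auto simp: semistandard_tableaux_def PiE_iff)
    then have "restrict T (?Y (shape T)) \<in> ?Y (shape T) \<rightarrow>\<^sub>E {1..n}"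
      by (simp add: PiE_iff)
    moreover have "restrict T (?Y (shape T)) (i, j) \<le> restrict T (?Y (shape T)) (i, j')"
      if "j < j'" "(i, j') \<in> ?Y (shape T)" for i j j'
    proof -
      have "(i, j) \<in> ?Y (shape T)" "(i, j') \<in> ?Y \<mu>"
        using that sub[OF strip_shape[OF T]] by (auto simp: young_diagram_def)
      then show ?thesis
        using that T by (auto simp: semistandard_tableaux_def)
    qed
    moreover have "restrict T (?Y (shape T)) (i, j) < restrict T (?Y (shape T)) (i', j)"
      if "i < i'" "(i', j) \<in> ?Y (shape T)" for i i' j
    proof -
      have "(i, j) \<in> ?Y (shape T)" "(i', j) \<in> ?Y \<mu>"
        using that sub[OF strip_shape[OF T]] partition_antimono[OF part', of i i']
        by (auto simp: young_diagram_def)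
      then show ?thesis
        using that T by (auto simp: semistandard_tableaux_def)
    qed
    ultimately show ?thesis
      by (simp add: semistandard_tableaux_def)
  qed
  have restr_ext: "restrict (ext \<nu> T) (?Y \<nu>) = T" if T: "T \<in> ?SS n \<nu>" for \<nu> T
  proof -
    have "T \<in> ?Y \<nu> \<rightarrow>\<^sub>E {1..n}"
      using T by (simp add: semistandard_tableaux_def)
    then have "restrict T (?Y \<nu>) = T"
      by (rule PiE_restrict)
    moreover have "restrict (ext \<nu> T) (?Y \<nu>) = restrict T (?Y \<nu>)"
      by (rule restrict_ext) (simp add: ext_def)
    ultimately show ?thesis
      by simp
  qed
  have prod: "(\<Prod>c\<in>?Y \<mu>. y (ext \<nu> T c)) = (\<Prod>c\<in>?Y \<nu>. y (T c)) * y (Suc n) ^ (psize \<mu> - psize \<nu>)"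
    if \<nu>: "strip \<mu> \<nu>" for \<nu> T
  proof -
    have part': "is_partition \<nu>"
      using strip_partition[OF \<nu> part] .
    have "(\<Prod>c\<in>?Y \<mu>. y (ext \<nu> T c)) = (\<Prod>c\<in>?Y \<mu> - ?Y \<nu>. y (ext \<nu> T c)) * (\<Prod>c\<in>?Y \<nu>. y (ext \<nu> T c))"
      by (rule prod.subset_diff[OF sub[OF \<nu>] finite_young_diagram[OF part]])
    also have "(\<Prod>c\<in>?Y \<nu>. y (ext \<nu> T c)) = (\<Prod>c\<in>?Y \<nu>. y (T c))"
      by (intro prod.cong) (auto simp: ext_def)
    also have "(\<Prod>c\<in>?Y \<mu> - ?Y \<nu>. y (ext \<nu> T c)) = (\<Prod>c\<in>?Y \<mu> - ?Y \<nu>. y (Suc n))"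
      by (intro prod.cong) (auto simp: ext_def)
    also have "\<dots> = y (Suc n) ^ (psize \<mu> - psize \<nu>)"
      by (simp add: card_Diff_subset finite_young_diagram part' sub[OF \<nu>] card_young_diagram part)
    finally show ?thesis
      by (simp add: mult.commute)
  qed
  have "(\<Sum>\<nu> | strip \<mu> \<nu>. schur n \<nu> y * y (Suc n) ^ (psize \<mu> - psize \<nu>)) =
      (\<Sum>(\<nu>, T)\<in>Sigma {\<nu>. strip \<mu> \<nu>} (\<lambda>\<nu>. ?SS n \<nu>). (\<Prod>c\<in>?Y \<mu>. y (ext \<nu> T c)))"
    unfolding schur_def sum_distrib_right
    using finite_strip[OF part] strip_partition[OF _ part]
    by (subst sum.Sigma) (auto intro!: sum.cong finite_semistandard_tableaux simp: prod)
  also have "\<dots> = (\<Sum>T\<in>?SS (Suc n) \<mu>. (\<Prod>c\<in>?Y \<mu>. y (T c)))"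
    by (rule sum.reindex_bij_witness
        [where j = "\<lambda>(\<nu>, T). ext \<nu> T" and i = "\<lambda>T. (shape T, restrict T (?Y (shape T)))"])
      (auto simp: ext_eq ext_SS shape_ext restr_ext strip_shape restr_SS)
  finally show ?thesis
    by (simp add: schur_def)
qed

lemma schur_0:
  assumes "is_partition \<mu>"
  shows "schur 0 \<mu> y = (if \<mu> = (\<lambda>_. 0) then 1 else 0)"
proof (cases "\<mu> = (\<lambda>_. 0)")
  case True
  then have "young_diagram \<mu> = {}"
    by (auto simp: young_diagram_def)
  moreover from this have "semistandard_tableaux 0 \<mu> = {\<lambda>_. undefined}"
    by (auto simp: semistandard_tableaux_def)
  ultimately show ?thesis
    using True by (simp add: schur_def)
next
  case False
  then obtain i where "(i, 0) \<in> young_diagram \<mu>"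
    by (auto simp: young_diagram_def fun_eq_iff)
  then have "semistandard_tableaux 0 \<mu> = {}"
    by (auto simp: semistandard_tableaux_def PiE_def Pi_def)
  with False show ?thesis
    by (simp add: schur_def)
qed

text \<open>A strict column longer than n cannot be filled with n letters. In the induction,
  interlacing keeps row n of every \<nu> nonempty.\<close>

lemma schur_too_many_rows:
  assumes "is_partition \<mu>" "\<mu> n \<noteq> 0"
  shows "schur n \<mu> y = 0"
  using assms
proof (induction n arbitrary: \<mu>)
  case 0
  then show ?case
    by (auto simp: schur_0)
next
  case (Suc n)
  have "schur n \<nu> y = 0" if "strip \<mu> \<nu>" for \<nu>
    using Suc.prems stripD(2)[OF that, of n] strip_partition[OF that]
    by (intro Suc.IH) auto
  then show ?case
    by (simp add: schur_branching Suc.prems)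
qed

text \<open>The commutation of adding and removing a box, which drives the induction on the number of
  variables in Pieri's rule.\<close>

lemma card_insert_box_strip:
  assumes \<mu>: "is_partition \<mu>" and supp: "\<And>i. i \<ge> M \<Longrightarrow> \<mu> i = 0" and \<nu>: "is_partition \<nu>"
  shows "card {i. i \<le> M \<and> strip (\<mu>(i := Suc (\<mu> i))) \<nu>} =
    card {i. i \<le> M \<and> \<nu> i > 0 \<and> strip \<mu> (\<nu>(i := \<nu> i - 1))} + (if strip \<mu> \<nu> then 1 else 0)"
proof (cases "strip \<mu> \<nu>")
  case True
  \<comment> \<open>C collects the rows of \<nu> that can lose a box. When \<mu>/\<nu> is already a
    strip, \<mu> can gain a box in row i+1 exactly if \<nu> can lose one in row i. Row 0 of \<mu>
    can always gain a box and has no partner, which yields the extra 1.\<close>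
  define C where "C = {i. i < M \<and> \<mu> (Suc i) < \<nu> i}"
  have "strip (\<mu>(i := Suc (\<mu> i))) \<nu> \<longleftrightarrow> (i = 0 \<or> \<mu> i < \<nu> (i - 1))" for i
  proof
    assume "strip (\<mu>(i := Suc (\<mu> i))) \<nu>"
    from stripD(2)[OF this, of "i - 1"] show "i = 0 \<or> \<mu> i < \<nu> (i - 1)"
      by (cases i) auto
  next
    assume "i = 0 \<or> \<mu> i < \<nu> (i - 1)"
    then show "strip (\<mu>(i := Suc (\<mu> i))) \<nu>"
      using stripD[OF True] by (auto simp: strip_def le_Suc_eq)
  qed
  then have "{i. i \<le> M \<and> strip (\<mu>(i := Suc (\<mu> i))) \<nu>} = {i. i \<le> M \<and> (i = 0 \<or> \<mu> i < \<nu> (i - 1))}"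
    by simp
  also have "\<dots> = insert 0 (Suc ` C)"
  proof (rule set_eqI)
    show "i \<in> {i. i \<le> M \<and> (i = 0 \<or> \<mu> i < \<nu> (i - 1))} \<longleftrightarrow> i \<in> insert 0 (Suc ` C)" for i
      by (cases i) (auto simp: C_def)
  qed
  finally have "{i. i \<le> M \<and> strip (\<mu>(i := Suc (\<mu> i))) \<nu>} = insert 0 (Suc ` C)" .
  moreover have "i \<le> M \<and> \<nu> i > 0 \<and> strip \<mu> (\<nu>(i := \<nu> i - 1)) \<longleftrightarrow> i \<in> C" for i
  proof
    assume *: "i \<le> M \<and> \<nu> i > 0 \<and> strip \<mu> (\<nu>(i := \<nu> i - 1))"
    then have "\<mu> (Suc i) < \<nu> i"
      using stripD(2)[of \<mu> "\<nu>(i := \<nu> i - 1)" i] by auto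
    moreover have "i \<noteq> M"
      using * stripD(1)[OF True, of i] supp[of M] by auto
    ultimately show "i \<in> C"
      using * by (simp add: C_def)
  next
    assume "i \<in> C"
    then show "i \<le> M \<and> \<nu> i > 0 \<and> strip \<mu> (\<nu>(i := \<nu> i - 1))"
      using stripD[OF True] by (auto simp: C_def strip_def le_diff_conv intro: le_SucI)
  qed
  ultimately show ?thesis
    using True by (auto simp: card_image C_def)
next
  case False
  \<comment> \<open>When \<mu>/\<nu> is not a strip, either side forces
    \<open>\<nu> i = Suc (\<mu> i)\<close> as the only violation. Raising \<mu> or lowering \<nu> in
    that same row repairs it, so the rows correspond without a shift.\<close>
  have "strip (\<mu>(i := Suc (\<mu> i))) \<nu> \<longleftrightarrow> \<nu> i > 0 \<and> strip \<mu> (\<nu>(i := \<nu> i - 1))" for i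
  proof
    assume *: "strip (\<mu>(i := Suc (\<mu> i))) \<nu>"
    have le: "\<mu> (Suc j) \<le> \<nu> j" for j
      using stripD(2)[OF *, of j] by (auto split: if_splits)
    have le': "\<nu> j \<le> \<mu> j" if "j \<noteq> i" for j
      using stripD(1)[OF *, of j] that by simp
    have "\<nu> i = Suc (\<mu> i)"
      using False stripD(1)[OF *, of i] le le' unfolding strip_def
      by (metis fun_upd_same le_SucE)
    then show "\<nu> i > 0 \<and> strip \<mu> (\<nu>(i := \<nu> i - 1))"
      using le le' partition_Suc_le[OF \<mu>] by (auto simp: strip_def)
  next
    assume *: "\<nu> i > 0 \<and> strip \<mu> (\<nu>(i := \<nu> i - 1))"
    then have s: "strip \<mu> (\<nu>(i := \<nu> i - 1))" and "\<nu> i > 0"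
      by auto
    have le: "\<mu> (Suc j) \<le> \<nu> j" for j
      using stripD(2)[OF s, of j] by (auto split: if_splits)
    have le': "\<nu> j \<le> \<mu> j" if "j \<noteq> i" for j
      using stripD(1)[OF s, of j] that by simp
    have "\<not> \<nu> i \<le> \<mu> i"
      using False le le' unfolding strip_def by metis
    with stripD(1)[OF s, of i] have eq: "\<nu> i = Suc (\<mu> i)"
      by simp
    then show "strip (\<mu>(i := Suc (\<mu> i))) \<nu>"
      using le le' partition_Suc_le[OF \<nu>] unfolding strip_def
      by (metis eq fun_upd_apply le_refl)
  qed
  with False show ?thesis
    by simp
qed

text \<open>The parts of \<nu> separate consecutive parts of the enlarged sequence. Hence the rows
  counted in \<open>card_insert_box_strip\<close> are automatically rows where adding a box gives a
  partition.\<close>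

lemma strip_add_box_partition:
  assumes "strip (\<mu>(i := Suc (\<mu> i))) \<nu>" "is_partition \<mu>" "is_partition \<nu>"
  shows "is_partition (\<mu>(i := Suc (\<mu> i)))"
proof -
  obtain M where M: "\<And>i. i \<ge> M \<Longrightarrow> \<mu> i = 0"
    using partition_supp[OF assms(2)] by blast
  show ?thesis
  proof (rule is_partitionI)
    show "(\<mu>(i := Suc (\<mu> i))) (Suc j) \<le> (\<mu>(i := Suc (\<mu> i))) j" for j
      using stripD[OF assms(1), of j] by (rule le_trans[rotated])
    show "(\<mu>(i := Suc (\<mu> i))) j = 0" if "max M (Suc i) \<le> j" for j
      using that M by auto
  qed
qed

lemma psize_strip_le:
  assumes "strip \<mu> \<nu>" "is_partition \<mu>"
  shows "psize \<nu> \<le> psize \<mu>"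
proof -
  obtain M where M: "\<And>i. i \<ge> M \<Longrightarrow> \<mu> i = 0"
    using partition_supp[OF assms(2)] by blast
  have "\<nu> i = 0" if "i \<ge> M" for i
    using M[OF that] stripD(1)[OF assms(1), of i] by simp
  then show ?thesis
    using M stripD(1)[OF assms(1)] by (simp add: psize_eq_sum[of M] sum_mono)
qed

text \<open>Induction on the number of variables. After branching, the induction hypothesis adds a
  box to each \<nu>, and the last variable contributes each \<nu> itself. Counting how often each
  shape arises turns this into branching of the enlarged \<mu>. A new box can only lie in rows 0 to
  M, hence the bound.\<close>

lemma schur_pieri_box:
  assumes "is_partition \<mu>" and "\<And>i. i \<ge> M \<Longrightarrow> \<mu> i = 0"
  shows "(\<Sum>j=1..n. y j) * schur n \<mu> y =
    (\<Sum>i | i \<le> M \<and> is_partition (\<mu>(i := Suc (\<mu> i))). schur n (\<mu>(i := Suc (\<mu> i))) y)"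
  using assms
proof (induction n arbitrary: \<mu>)
  case 0
  have "\<mu>(i := Suc (\<mu> i)) \<noteq> (\<lambda>_. 0)" for i
    by (metis fun_upd_same nat.distinct(1))
  then show ?case
    by (simp add: schur_0 del: fun_upd_apply)
next
  case (Suc n)
  let ?add = "\<lambda>\<nu> i. \<nu>(i := Suc (\<nu> i :: nat)) :: nat \<Rightarrow> nat"
    and ?del = "\<lambda>\<nu> i. \<nu>(i := \<nu> i - 1 :: nat) :: nat \<Rightarrow> nat"
  let ?z = "y (Suc n)"
  \<comment> \<open>A finite set containing every shape that occurs on either side, so that the
    multiplicities of \<open>g \<nu>\<close> can be compared shape by shape.\<close>
  define U where "U = {\<nu> :: nat \<Rightarrow> nat. is_partition \<nu> \<and> (\<forall>i<Suc M. \<nu> i \<le> Suc (\<mu> 0)) \<and> (\<forall>i\<ge>Suc M. \<nu> i = 0)}"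
  \<comment> \<open>The contribution of \<nu> when a shape of size \<open>Suc (psize \<mu>)\<close>
    is branched; its exponent is the same for every position of the added box.\<close>
  define g where "g \<nu> = schur n \<nu> y * ?z ^ (Suc (psize \<mu>) - psize \<nu>)" for \<nu>
  have finU: "finite U"
    unfolding U_def by (rule finite_subset[OF _ finite_bounded_funs[of "Suc M" "Suc (\<mu> 0)"]]) auto
  have \<mu>_le: "\<mu> i \<le> \<mu> 0" for i
    using partition_antimono[OF Suc.prems(1), of 0 i] by simp
  have strip_add_U: "\<nu> \<in> U" if "i \<le> M" "strip (?add \<mu> i) \<nu>" "is_partition (?add \<mu> i)" for \<nu> i
  proof -
    have "\<nu> j \<le> Suc (\<mu> 0)" for j
      using stripD(1)[OF that(2), of j] \<mu>_le[of j] by (auto split: if_splits)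
    moreover have "\<nu> j = 0" if "j \<ge> Suc M" for j
      using stripD(1)[OF \<open>strip (?add \<mu> i) \<nu>\<close>, of j] Suc.prems(2)[of j] that \<open>i \<le> M\<close> by auto
    ultimately show ?thesis
      using strip_partition[OF that(2,3)] by (simp add: U_def)
  qed
  have strip_U: "\<nu> \<in> U" if "strip \<mu> \<nu>" for \<nu>
  proof -
    have "\<nu> j \<le> Suc (\<mu> 0)" for j
      using stripD(1)[OF that, of j] \<mu>_le[of j] by simp
    moreover have "\<nu> j = 0" if "j \<ge> Suc M" for j
      using stripD(1)[OF \<open>strip \<mu> \<nu>\<close>, of j] Suc.prems(2)[of j] that by auto
    ultimately show ?thesis
      using strip_partition[OF that Suc.prems(1)] by (simp add: U_def)
  qed
  have del_U: "\<nu> \<in> U" if "i \<le> M" "is_partition \<nu>" "strip \<mu> (?del \<nu> i)" for \<nu> i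
  proof -
    have "\<nu> j \<le> Suc (\<mu> 0)" for j
      using stripD(1)[OF that(3), of j] \<mu>_le[of j] by (auto split: if_splits)
    moreover have "\<nu> j = 0" if "j \<ge> Suc M" for j
      using stripD(1)[OF \<open>strip \<mu> (?del \<nu> i)\<close>, of j] Suc.prems(2)[of j] that \<open>i \<le> M\<close>
      by (auto split: if_splits)
    ultimately show ?thesis
      using that(2) by (simp add: U_def)
  qed
  have add_U: "?add \<nu> i \<in> U" if "i \<le> M" "strip \<mu> \<nu>" "is_partition (?add \<nu> i)" for \<nu> i
    using that by (intro del_U[of i]) auto
  have U_part: "is_partition \<nu>" if "\<nu> \<in> U" for \<nu>
    using that by (simp add: U_def)
  have strip_supp: "\<nu> i = 0" if "strip \<mu> \<nu>" "i \<ge> M" for \<nu> i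
    using stripD(1)[OF that(1), of i] Suc.prems(2)[OF that(2)] by simp
  have L1: "(\<Sum>j=1..n. y j) * schur n \<nu> y * ?z ^ (psize \<mu> - psize \<nu>) =
      (\<Sum>i | i \<le> M \<and> is_partition (?add \<nu> i). g (?add \<nu> i))" if \<nu>: "strip \<mu> \<nu>" for \<nu>
  proof -
    have \<nu>': "is_partition \<nu>"
      using strip_partition[OF \<nu> Suc.prems(1)] .
    have IH: "(\<Sum>j=1..n. y j) * schur n \<nu> y = (\<Sum>i | i \<le> M \<and> is_partition (?add \<nu> i). schur n (?add \<nu> i) y)"
      by (rule Suc.IH[OF \<nu>' strip_supp[OF \<nu>]])
    show ?thesis
      unfolding IH by (simp add: sum_distrib_right g_def psize_add_box[OF \<nu>'] del: fun_upd_apply)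
  qed
  have L2: "?z * schur n \<nu> y * ?z ^ (psize \<mu> - psize \<nu>) = g \<nu>" if \<nu>: "strip \<mu> \<nu>" for \<nu>
    using psize_strip_le[OF \<nu> Suc.prems(1)] by (simp add: g_def Suc_diff_le algebra_simps)
  have "(\<Sum>j=1..Suc n. y j) * schur (Suc n) \<mu> y =
      (\<Sum>\<nu> | strip \<mu> \<nu>. (\<Sum>j=1..n. y j) * schur n \<nu> y * ?z ^ (psize \<mu> - psize \<nu>)
        + ?z * schur n \<nu> y * ?z ^ (psize \<mu> - psize \<nu>))"
    unfolding schur_branching[OF Suc.prems(1)] sum_distrib_left
    by (intro sum.cong) (simp_all add: distrib_right mult.assoc)
  also have "\<dots> = (\<Sum>\<nu> | strip \<mu> \<nu>. \<Sum>i | i \<le> M \<and> is_partition (?add \<nu> i). g (?add \<nu> i))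
      + (\<Sum>\<nu> | strip \<mu> \<nu>. g \<nu>)"
    unfolding sum.distrib by (intro arg_cong2[of _ _ _ _ "(+)"] sum.cong refl L1 L2) simp_all
  also have "(\<Sum>\<nu> | strip \<mu> \<nu>. \<Sum>i | i \<le> M \<and> is_partition (?add \<nu> i). g (?add \<nu> i)) =
      (\<Sum>(\<nu>, i)\<in>Sigma {\<nu>. strip \<mu> \<nu>} (\<lambda>\<nu>. {i. i \<le> M \<and> is_partition (?add \<nu> i)}). g (?add \<nu> i))"
    by (rule sum.Sigma) (auto simp: finite_strip Suc.prems(1))
  \<comment> \<open>Each pair is renamed by the enlarged shape, so that the inner sum counts the
    rows from which a box can be taken back.\<close>
  also have "\<dots> = (\<Sum>(\<nu>, i)\<in>Sigma U (\<lambda>\<nu>. {i. i \<le> M \<and> \<nu> i > 0 \<and> strip \<mu> (?del \<nu> i)}). g \<nu>)"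
    by (rule sum.reindex_bij_witness
        [where j = "\<lambda>(\<nu>, i). (?add \<nu> i, i)" and i = "\<lambda>(\<nu>, i). (?del \<nu> i, i)"])
      (auto intro: add_U del_U U_part)
  also have "\<dots> = (\<Sum>\<nu>\<in>U. of_nat (card {i. i \<le> M \<and> \<nu> i > 0 \<and> strip \<mu> (?del \<nu> i)}) * g \<nu>)"
    by (subst sum.Sigma[symmetric]) (auto simp: finU)
  also have "(\<Sum>\<nu> | strip \<mu> \<nu>. g \<nu>) = (\<Sum>\<nu>\<in>U. if strip \<mu> \<nu> then g \<nu> else 0)"
    using strip_U by (simp add: sum.If_cases finU Int_absorb1 subset_iff)
  \<comment> \<open>Here \<open>card_insert_box_strip\<close> is applied for every shape in U; the
    second sum supplies its extra 1.\<close>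
  also have "(\<Sum>\<nu>\<in>U. of_nat (card {i. i \<le> M \<and> \<nu> i > 0 \<and> strip \<mu> (?del \<nu> i)}) * g \<nu>) + \<dots> =
      (\<Sum>\<nu>\<in>U. of_nat (card {i. i \<le> M \<and> strip (?add \<mu> i) \<nu>}) * g \<nu>)"
    using Suc.prems
    by (subst sum.distrib[symmetric], intro sum.cong)
      (auto simp: U_def card_insert_box_strip algebra_simps)
  also have "\<dots> = (\<Sum>(\<nu>, i)\<in>Sigma U (\<lambda>\<nu>. {i. i \<le> M \<and> strip (?add \<mu> i) \<nu>}). g \<nu>)"
    by (subst sum.Sigma[symmetric]) (auto simp: finU)
  also have "\<dots> = (\<Sum>(i, \<nu>)\<in>Sigma {i. i \<le> M \<and> is_partition (?add \<mu> i)} (\<lambda>i. {\<nu>. strip (?add \<mu> i) \<nu>}). g \<nu>)"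
    by (rule sum.reindex_bij_witness
        [where j = "\<lambda>(\<nu>, i). (i, \<nu>)" and i = "\<lambda>(i, \<nu>). (\<nu>, i)"])
      (auto intro: strip_add_U strip_add_box_partition[OF _ Suc.prems(1) U_part])
  also have "\<dots> = (\<Sum>i | i \<le> M \<and> is_partition (?add \<mu> i). \<Sum>\<nu> | strip (?add \<mu> i) \<nu>. g \<nu>)"
    by (subst sum.Sigma[symmetric]) (auto simp: finite_strip)
  also have "\<dots> = (\<Sum>i | i \<le> M \<and> is_partition (?add \<mu> i). schur (Suc n) (?add \<mu> i) y)"
    by (intro sum.cong) (auto simp: schur_branching g_def psize_add_box Suc.prems(1))
  finally show ?case .
qed

subsection \<open>Complete homogeneous polynomials\<close>

lemma is_partition_one_row [simp]: "is_partition (one_row k)"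
  by (rule is_partitionI[where M = 1]) (auto simp: one_row_def)

lemma psize_one_row [simp]: "psize (one_row k) = k"
  by (subst psize_eq_sum[where M = 1]) (auto simp: one_row_def)

lemma strip_one_row_iff: "strip (one_row k) \<nu> \<longleftrightarrow> (\<exists>j\<le>k. \<nu> = one_row j)"
proof
  assume s: "strip (one_row k) \<nu>"
  have "\<nu> i = one_row (\<nu> 0) i" for i
    using stripD(1)[OF s, of i] by (auto simp: one_row_def split: if_splits)
  moreover have "\<nu> 0 \<le> k"
    using stripD(1)[OF s, of 0] by (simp add: one_row_def)
  ultimately show "\<exists>j\<le>k. \<nu> = one_row j"
    by blast
qed (auto simp: strip_def one_row_def)

lemma schur_one_row_0: "schur 0 (one_row k) y = (if k = 0 then 1 else 0)"
proof -
  have "one_row k = (\<lambda>_. 0) \<longleftrightarrow> k = 0"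
    by (auto simp: one_row_def fun_eq_iff)
  then show ?thesis
    by (simp add: schur_0)
qed

lemma schur_one_row_Suc:
  "schur (Suc n) (one_row k) y = (\<Sum>j\<le>k. schur n (one_row j) y * y (Suc n) ^ (k - j))"
proof -
  have "inj_on one_row {..k}"
    by (auto simp: inj_on_def one_row_def fun_eq_iff)
  moreover have "{\<nu>. strip (one_row k) \<nu>} = one_row ` {..k}"
    by (auto simp: strip_one_row_iff)
  ultimately show ?thesis
    by (simp add: schur_branching sum.reindex)
qed

text \<open>A monomial of degree k+1 either avoids the last variable or has it as a factor.\<close>

lemma schur_one_row_Suc_Suc:
  "schur (Suc n) (one_row (Suc k)) y =
    schur n (one_row (Suc k)) y + y (Suc n) * schur (Suc n) (one_row k) y"
  by (simp add: schur_one_row_Suc sum_distrib_left Suc_diff_le algebra_simps)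

lemma schur_one_row_zero [simp]: "schur n (one_row 0) y = 1"
  by (induction n) (simp_all add: schur_one_row_0 schur_one_row_Suc)

text \<open>In generating functions, 1/(1 - (q - x)t) = (1 - qt)^(-1) / (1 + xt/(1 - qt)). The
  product over n variables is the sum over r of (-1)^r h_r(x) t^r (1 - qt)^(-n-r), and the
  coefficient of t^k gives the binomials. Their upper index does not depend on r, which later
  permits the binomial theorem. The proof is a double induction with
  \<open>schur_one_row_Suc_Suc\<close> and Pascal's rule.\<close>

lemma schur_one_row_shift:
  "schur n (one_row k) (\<lambda>i. q - x i) =
    (\<Sum>r\<le>k. (- 1) ^ r * of_nat ((k + n - 1) choose (k - r)) * (q ^ (k - r) * schur n (one_row r) x))"
proof (induction n arbitrary: k)
  case 0
  \<comment> \<open>Without variables only r = 0 contributes. Its binomial is k-1 over k, which is 0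
    for k > 0, while for k = 0 truncated subtraction makes it 0 over 0, which is 1.\<close>
  show ?case
    by (cases k) (simp_all add: schur_one_row_0 if_distrib[of "\<lambda>u. _ * u"] sum.delta
        binomial_eq_0 cong: if_cong)
next
  case (Suc n)
  note IH_n = Suc.IH
  show ?case
  proof (induction k)
    case 0
    show ?case by simp
  next
    case (Suc k)
    let ?h = "\<lambda>n r. schur n (one_row r) x" and ?z = "x (Suc n)"
    \<comment> \<open>Both induction hypotheses, for (n, k+1) and for (n+1, k), have upper index
      k+n, so one family c serves both. The goal has upper index k+n+1 and is split by Pascal's
      rule.\<close>
    define c where "c r m = (- 1) ^ r * of_nat ((k + n) choose m) * q ^ m" for r m
    have c_Suc: "c (Suc r) m = - c r m" for r m
      by (simp add: c_def)
    have IH1: "schur n (one_row (Suc k)) (\<lambda>i. q - x i) = (\<Sum>r\<le>Suc k. c r (Suc k - r) * ?h n r)"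
      unfolding IH_n by (intro sum.cong) (simp_all add: c_def mult.assoc)
    have IH2: "schur (Suc n) (one_row k) (\<lambda>i. q - x i) = (\<Sum>r\<le>k. c r (k - r) * ?h (Suc n) r)"
      unfolding Suc.IH by (intro sum.cong) (simp_all add: c_def mult.assoc)
    \<comment> \<open>The r = 0 term drops out because h_0 = 1. The others lose a factor
      \<open>x (Suc n)\<close> by the recurrence, and the index shift changes the sign.\<close>
    have "(\<Sum>r\<le>Suc k. c r (Suc k - r) * (?h (Suc n) r - ?h n r)) =
        (\<Sum>r\<le>k. c (Suc r) (k - r) * (?h (Suc n) (Suc r) - ?h n (Suc r)))"
      by (subst sum.atMost_Suc_shift) simp
    also have "\<dots> = - ?z * (\<Sum>r\<le>k. c r (k - r) * ?h (Suc n) r)"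
      unfolding sum_distrib_left
      by (intro sum.cong) (simp_all add: c_Suc schur_one_row_Suc_Suc algebra_simps)
    finally have z: "(\<Sum>r\<le>Suc k. c r (Suc k - r) * ?h (Suc n) r) =
        (\<Sum>r\<le>Suc k. c r (Suc k - r) * ?h n r) - ?z * (\<Sum>r\<le>k. c r (k - r) * ?h (Suc n) r)"
      by (simp add: right_diff_distrib sum_subtractf algebra_simps)
    have pascal: "(- 1) ^ r * of_nat ((Suc k + Suc n - 1) choose (Suc k - r)) * (q ^ (Suc k - r) * u) =
        c r (Suc k - r) * u + q * (if r \<le> k then c r (k - r) * u else 0)" if "r \<le> Suc k" for r u
      using that by (cases "r \<le> k") (auto simp: c_def Suc_diff_le algebra_simps le_Suc_eq)
    have "(\<Sum>r\<le>Suc k. (- 1) ^ r * of_nat ((Suc k + Suc n - 1) choose (Suc k - r)) *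
          (q ^ (Suc k - r) * ?h (Suc n) r)) =
        (\<Sum>r\<le>Suc k. c r (Suc k - r) * ?h (Suc n) r + q * (if r \<le> k then c r (k - r) * ?h (Suc n) r else 0))"
      by (intro sum.cong) (simp_all only: pascal atMost_iff)
    also have "\<dots> = (\<Sum>r\<le>Suc k. c r (Suc k - r) * ?h (Suc n) r) + q * (\<Sum>r\<le>k. c r (k - r) * ?h (Suc n) r)"
      unfolding sum.distrib sum_distrib_left[symmetric] by simp
    also have "\<dots> = schur (Suc n) (one_row (Suc k)) (\<lambda>i. q - x i)"
      unfolding z schur_one_row_Suc_Suc[of n k "\<lambda>i. q - x i"] IH1 IH2 by (simp add: algebra_simps)
    finally show ?case ..
  qed
qed

subsection \<open>Standard tableaux\<close>

definition corners :: "(nat \<Rightarrow> nat) \<Rightarrow> nat set" where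
  "corners \<mu> = {i. \<mu> (Suc i) < \<mu> i}"

lemma finite_corners: "is_partition \<mu> \<Longrightarrow> finite (corners \<mu>)"
  by (rule finite_subset[of _ "{i. \<mu> i \<noteq> 0}"]) (auto simp: corners_def is_partition_def)

lemma partition_del_box:
  assumes "is_partition \<mu>" "i \<in> corners \<mu>"
  shows "is_partition (\<mu>(i := \<mu> i - 1))"
proof -
  obtain M where M: "\<And>i. i \<ge> M \<Longrightarrow> \<mu> i = 0"
    using partition_supp[OF assms(1)] by blast
  show ?thesis
  proof (rule is_partitionI)
    show "(\<mu>(i := \<mu> i - 1)) (Suc j) \<le> (\<mu>(i := \<mu> i - 1)) j" for j
      using assms(2) partition_Suc_le[OF assms(1), of j] by (auto simp: corners_def)
    show "(\<mu>(i := \<mu> i - 1)) j = 0" if "j \<ge> M" for j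
      using M[OF that] by (cases "j = i") auto
  qed
qed

lemma psize_del_box:
  assumes "is_partition \<mu>" "i \<in> corners \<mu>"
  shows "psize \<mu> = Suc (psize (\<mu>(i := \<mu> i - 1)))"
proof -
  have "\<mu> i > 0"
    using assms(2) by (auto simp: corners_def)
  then show ?thesis
    using psize_add_box[OF partition_del_box[OF assms], of i] by simp
qed

text \<open>The largest entry of a standard tableau occupies the end of a corner row; erasing it is
  a bijection onto the standard tableaux of the smaller shapes.\<close>

lemma num_SYT_rec:
  assumes part: "is_partition \<mu>" and pos: "psize \<mu> > 0"
  shows "num_SYT \<mu> = (\<Sum>i\<in>corners \<mu>. num_SYT (\<mu>(i := \<mu> i - 1)))"
proof -
  let ?Y = young_diagram and ?del = "\<lambda>i. \<mu>(i := \<mu> i - 1)" and ?N = "psize \<mu>"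
  define cell where "cell i = (i, \<mu> i - 1)" for i
  have SYT_iff: "T \<in> standard_tableaux \<nu> \<longleftrightarrow> T \<in> extensional (?Y \<nu>) \<and>
      bij_betw T (?Y \<nu>) {1..psize \<nu>} \<and>
      (\<forall>i j j'. j < j' \<and> (i, j') \<in> ?Y \<nu> \<longrightarrow> T (i, j) < T (i, j')) \<and>
      (\<forall>i i' j. i < i' \<and> (i', j) \<in> ?Y \<nu> \<longrightarrow> T (i, j) < T (i', j))" for T \<nu>
    by (auto simp: standard_tableaux_def PiE_def bij_betw_def)
  have Y_del: "?Y \<mu> = insert (cell i) (?Y (?del i))" "cell i \<notin> ?Y (?del i)" if "i \<in> corners \<mu>" for i
    using that by (auto simp: young_diagram_def cell_def corners_def split: if_splits)
  have N_del: "?N = Suc (psize (?del i))" if "i \<in> corners \<mu>" for i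
    using psize_del_box[OF part that] .
  have no_right: "(i, j) \<notin> ?Y \<mu>" if "i \<in> corners \<mu>" "\<mu> i - 1 < j" for i j
    using that by (auto simp: young_diagram_def)
  have no_below: "(i', \<mu> i - 1) \<notin> ?Y \<mu>" if "i \<in> corners \<mu>" "i < i'" for i i'
    using that partition_antimono[OF part, of "Suc i" i'] by (auto simp: young_diagram_def corners_def)
  have ext: "T(cell i := ?N) \<in> standard_tableaux \<mu>"
    if i: "i \<in> corners \<mu>" and T: "T \<in> standard_tableaux (?del i)" for i T
  proof -
    note Y = Y_del[OF i]
    have bij: "bij_betw T (?Y (?del i)) {1..psize (?del i)}"
      using T by (simp add: SYT_iff)
    have less: "T c < ?N" if "c \<in> ?Y (?del i)" for c
      using bij_betwE[OF bij] that N_del[OF i] by fastforce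
    have "bij_betw (T(cell i := ?N)) (?Y (?del i)) {1..psize (?del i)}"
      using bij by (rule bij_betw_cong[THEN iffD1, rotated]) (use Y in auto)
    then have "bij_betw (T(cell i := ?N)) (?Y \<mu>) {1..?N}"
      using Y N_del[OF i] notIn_Un_bij_betw[of "cell i" "?Y (?del i)" "T(cell i := ?N)" "{1..psize (?del i)}"]
      by (simp add: atLeastAtMostSuc_conv)
    moreover have "T(cell i := ?N) \<in> extensional (?Y \<mu>)"
      using T Y by (auto simp: SYT_iff extensional_def)
    moreover have "(T(cell i := ?N)) (r, j) < (T(cell i := ?N)) (r, j')"
      if "j < j'" "(r, j') \<in> ?Y \<mu>" for r j j'
    proof -
      have ne: "(r, j) \<noteq> cell i"
        using no_right[OF i, of j'] that by (auto simp: cell_def)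
      have "(r, j) \<in> ?Y \<mu>"
        using that by (auto simp: young_diagram_def)
      then have "(r, j) \<in> ?Y (?del i)"
        using ne Y by auto
      then show ?thesis
        using ne that Y less T by (auto simp: SYT_iff)
    qed
    moreover have "(T(cell i := ?N)) (r, j) < (T(cell i := ?N)) (r', j)"
      if "r < r'" "(r', j) \<in> ?Y \<mu>" for r r' j
    proof -
      have ne: "(r, j) \<noteq> cell i"
        using no_below[OF i, of r'] that by (auto simp: cell_def)
      have "(r, j) \<in> ?Y \<mu>"
        using that partition_antimono[OF part, of r r'] by (auto simp: young_diagram_def)
      then have "(r, j) \<in> ?Y (?del i)"
        using ne Y by auto
      then show ?thesis
        using ne that Y less T by (auto simp: SYT_iff)
    qed
    ultimately show ?thesis
      unfolding SYT_iff by blast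
  qed
  have restr: "T(cell i := undefined) \<in> standard_tableaux (?del i)"
    if i: "i \<in> corners \<mu>" and T: "T \<in> standard_tableaux \<mu>" and Ti: "T (cell i) = ?N" for i T
  proof -
    note Y = Y_del[OF i]
    have "bij_betw T (?Y \<mu>) {1..?N}"
      using T by (simp add: SYT_iff)
    then have "bij_betw T (?Y (?del i)) {1..psize (?del i)}"
      using Y N_del[OF i] Ti notIn_Un_bij_betw3[of "cell i" "?Y (?del i)" T "{1..psize (?del i)}"]
      by (simp add: atLeastAtMostSuc_conv)
    then have "bij_betw (T(cell i := undefined)) (?Y (?del i)) {1..psize (?del i)}"
      by (rule bij_betw_cong[THEN iffD1, rotated]) (use Y in auto)
    moreover have "T(cell i := undefined) \<in> extensional (?Y (?del i))"
      using T Y by (auto simp: SYT_iff extensional_def)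
    moreover have "(T(cell i := undefined)) (r, j) < (T(cell i := undefined)) (r, j')"
      if "j < j'" "(r, j') \<in> ?Y (?del i)" for r j j'
    proof -
      have "(r, j') \<in> ?Y \<mu>" "(r, j') \<noteq> cell i" "(r, j) \<noteq> cell i"
        using that Y no_right[OF i, of j'] by (auto simp: cell_def)
      then show ?thesis
        using that T by (auto simp: SYT_iff)
    qed
    moreover have "(T(cell i := undefined)) (r, j) < (T(cell i := undefined)) (r', j)"
      if "r < r'" "(r', j) \<in> ?Y (?del i)" for r r' j
    proof -
      have "(r', j) \<in> ?Y \<mu>" "(r', j) \<noteq> cell i" "(r, j) \<noteq> cell i"
        using that Y no_below[OF i, of r'] by (auto simp: cell_def)
      then show ?thesis
        using that T by (auto simp: SYT_iff)
    qed
    ultimately show ?thesis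
      unfolding SYT_iff by blast
  qed
  \<comment> \<open>A cell to the right of the maximal entry, or below it, would need a larger
    entry.\<close>
  have corner_of_max: "\<exists>i\<in>corners \<mu>. T (cell i) = ?N" if T: "T \<in> standard_tableaux \<mu>" for T
  proof -
    have bij: "bij_betw T (?Y \<mu>) {1..?N}"
      using T by (simp add: SYT_iff)
    then have "?N \<in> T ` ?Y \<mu>"
      using pos by (simp add: bij_betw_def)
    then obtain i j where ij: "(i, j) \<in> ?Y \<mu>" "T (i, j) = ?N"
      by fastforce
    have le: "T c \<le> ?N" if "c \<in> ?Y \<mu>" for c
      using bij_betwE[OF bij] that by auto
    have "(i, Suc j) \<notin> ?Y \<mu>"
    proof
      assume *: "(i, Suc j) \<in> ?Y \<mu>"
      then have "T (i, j) < T (i, Suc j)"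
        using T by (simp add: SYT_iff)
      then show False
        using le[OF *] ij by simp
    qed
    then have j: "\<mu> i = Suc j"
      using ij by (auto simp: young_diagram_def)
    have "(Suc i, j) \<notin> ?Y \<mu>"
    proof
      assume *: "(Suc i, j) \<in> ?Y \<mu>"
      then have "T (i, j) < T (Suc i, j)"
        using T by (simp add: SYT_iff)
      then show False
        using le[OF *] ij by simp
    qed
    then have "i \<in> corners \<mu>"
      using j by (auto simp: young_diagram_def corners_def)
    then show ?thesis
      using j ij by (intro bexI[of _ i]) (simp_all add: cell_def)
  qed
  have unique: "i = i'" if "i \<in> corners \<mu>" "i' \<in> corners \<mu>" "T \<in> standard_tableaux \<mu>"
    "T (cell i) = ?N" "T (cell i') = ?N" for i i' T
  proof -
    have "inj_on T (?Y \<mu>)"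
      using that by (simp add: SYT_iff bij_betw_def)
    moreover have "cell i \<in> ?Y \<mu>" "cell i' \<in> ?Y \<mu>"
      using Y_del(1)[OF that(1)] Y_del(1)[OF that(2)] by blast+
    ultimately have "cell i = cell i'"
      using that(4,5) by (metis inj_onD)
    then show ?thesis
      by (simp add: cell_def)
  qed
  \<comment> \<open>The inverse map resets the erased cell to \<open>undefined\<close>;
    extensionality makes this the original value there.\<close>
  have undef: "T (cell i) = undefined" if "i \<in> corners \<mu>" "T \<in> standard_tableaux (?del i)" for i T
  proof -
    have "T \<in> extensional (?Y (?del i))"
      using that(2) by (simp add: SYT_iff)
    then show ?thesis
      by (rule extensional_arb[OF _ Y_del(2)[OF that(1)]])
  qed
  define I where "I T = (THE i. i \<in> corners \<mu> \<and> T (cell i) = ?N)" for T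
  have I_eq: "I T = i" if "i \<in> corners \<mu>" "T \<in> standard_tableaux \<mu>" "T (cell i) = ?N" for i T
    unfolding I_def using that unique by (intro the_equality) auto
  have I: "I T \<in> corners \<mu>" "T (cell (I T)) = ?N" if "T \<in> standard_tableaux \<mu>" for T
    using corner_of_max[OF that] I_eq[OF _ that] by auto
  have "bij_betw (\<lambda>(i, T). T(cell i := ?N)) (Sigma (corners \<mu>) (\<lambda>i. standard_tableaux (?del i)))
      (standard_tableaux \<mu>)"
  proof (rule bij_betw_byWitness[where f' = "\<lambda>T. (I T, T(cell (I T) := undefined))"])
    show "\<forall>p\<in>Sigma (corners \<mu>) (\<lambda>i. standard_tableaux (?del i)).
        (\<lambda>T. (I T, T(cell (I T) := undefined))) ((\<lambda>(i, T). T(cell i := ?N)) p) = p"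
    proof
      fix p assume "p \<in> Sigma (corners \<mu>) (\<lambda>i. standard_tableaux (?del i))"
      then obtain i T where p: "p = (i, T)" and *: "i \<in> corners \<mu>" "T \<in> standard_tableaux (?del i)"
        by blast
      have "I (T(cell i := ?N)) = i"
        using ext[OF *] by (intro I_eq *) simp_all
      then show "(\<lambda>T. (I T, T(cell (I T) := undefined))) ((\<lambda>(i, T). T(cell i := ?N)) p) = p"
        using undef[OF *] by (simp add: p fun_upd_idem)
    qed
    show "\<forall>T\<in>standard_tableaux \<mu>. (\<lambda>(i, T). T(cell i := ?N)) (I T, T(cell (I T) := undefined)) = T"
      using I by (simp add: fun_upd_idem)
  qed (use I ext restr in auto)
  then have "num_SYT \<mu> = card (Sigma (corners \<mu>) (\<lambda>i. standard_tableaux (?del i)))"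
    by (simp add: num_SYT_def bij_betw_same_card)
  also have "\<dots> = (\<Sum>i\<in>corners \<mu>. card (standard_tableaux (?del i)))"
    using finite_corners[OF part] partition_del_box[OF part]
    by (intro card_SigmaI) (auto intro: finite_standard_tableaux)
  finally show ?thesis
    by (simp add: num_SYT_def)
qed

lemma num_SYT_empty: "num_SYT (\<lambda>_. 0) = 1"
proof -
  have "young_diagram (\<lambda>_. 0) = {}" "psize (\<lambda>_. 0) = 0"
    by (auto simp: young_diagram_def psize_def)
  then have "standard_tableaux (\<lambda>_. 0) = {\<lambda>_. undefined}"
    by (auto simp: standard_tableaux_def bij_betw_def)
  then show ?thesis
    by (simp add: num_SYT_def)
qed

subsection \<open>Alternants\<close>

text \<open>Alternants live in an auxiliary ring of integer polynomials whose variables are numbered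
  from zero, in accordance with the rows of partitions.\<close>

definition var :: "nat \<Rightarrow> int mpoly" where
  "var = indet"

text \<open>Exponent vectors are plain functions, so that they can be updated and added to
  partitions. \<open>Abs_poly_mapping\<close> is only meaningful at finite support, hence the
  finiteness hypotheses below.\<close>

definition mcoeff :: "int mpoly \<Rightarrow> (nat \<Rightarrow> nat) \<Rightarrow> int" where
  "mcoeff Q b = Poly_Mapping.lookup Q (Abs_poly_mapping b)"

lemma mcoeff_sum: "mcoeff (sum f A) b = (\<Sum>a\<in>A. mcoeff (f a) b)"
  by (simp add: mcoeff_def lookup_sum)

lemma mcoeff_of_int_mult: "mcoeff (of_int c * Q) b = c * mcoeff Q b"
proof (induction c)
  case (nonneg n)
  show ?case
    by (induction n) (simp_all add: mcoeff_def distrib_right lookup_add)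
next
  case (neg n)
  have "mcoeff (of_nat m * Q) b = of_nat m * mcoeff Q b" for m
    by (induction m) (simp_all add: mcoeff_def distrib_right lookup_add)
  from this[of "Suc n"] show ?case
    by (simp add: mcoeff_def del: of_nat_Suc)
qed

lemma lookup_single_mult:
  fixes Q :: "('a::cancel_comm_monoid_add) \<Rightarrow>\<^sub>0 'b::semiring_1"
  shows "Poly_Mapping.lookup (Poly_Mapping.single m 1 * Q) (m + k) = Poly_Mapping.lookup Q k"
  by (simp add: lookup_mult lookup_single when_mult)

lemma lookup_single_mult_eq_0:
  fixes Q :: "('a::cancel_comm_monoid_add) \<Rightarrow>\<^sub>0 'b::semiring_1"
  assumes "\<And>k. l \<noteq> m + k"
  shows "Poly_Mapping.lookup (Poly_Mapping.single m 1 * Q) l = 0"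
  by (simp add: lookup_mult lookup_single when_mult assms)

lemma mcoeff_var_mult:
  assumes "finite {i. b i \<noteq> 0}"
  shows "mcoeff (var i * Q) b = (if b i > 0 then mcoeff Q (b(i := b i - 1)) else 0)"
proof (cases "b i > 0")
  case True
  have "finite {j. (b(i := b i - 1)) j \<noteq> 0}"
    by (rule finite_subset[OF _ assms]) auto
  then have "Abs_poly_mapping b = Poly_Mapping.single i 1 + Abs_poly_mapping (b(i := b i - 1))"
    using assms True by (intro poly_mapping_eqI) (auto simp: lookup_add lookup_single when_def)
  then show ?thesis
    using True by (simp add: mcoeff_def var_def indet_def lookup_single_mult)
next
  case False
  have "Abs_poly_mapping b \<noteq> Poly_Mapping.single i 1 + k" for k :: "nat \<Rightarrow>\<^sub>0 nat"
  proof
    assume "Abs_poly_mapping b = Poly_Mapping.single i 1 + k"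
    then have "Poly_Mapping.lookup (Abs_poly_mapping b) i = Poly_Mapping.lookup (Poly_Mapping.single i 1 + k) i"
      by simp
    then show False
      using assms False by (simp add: lookup_add)
  qed
  then show ?thesis
    using False by (simp add: mcoeff_def var_def indet_def lookup_single_mult_eq_0)
qed

lemma mcoeff_one:
  assumes "finite {i. b i \<noteq> 0}"
  shows "mcoeff 1 b = (if b = (\<lambda>_. 0) then 1 else 0)"
proof -
  have "Abs_poly_mapping b = 0 \<longleftrightarrow> b = (\<lambda>_. 0)"
    using assms by (metis Abs_poly_mapping lookup_Abs_poly_mapping lookup_zero ext)
  then show ?thesis
    by (simp add: mcoeff_def lookup_one when_def)
qed

lemma mcoeff_var_power_mult:
  assumes "finite {i. b i \<noteq> 0}"
  shows "mcoeff (var i ^ e * Q) b = (if b i \<ge> e then mcoeff Q (b(i := b i - e)) else 0)"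
  using assms
proof (induction e arbitrary: b)
  case 0
  then show ?case by simp
next
  case (Suc e)
  have "finite {j. (b(i := b i - 1)) j \<noteq> 0}"
    by (rule finite_subset[OF _ Suc.prems]) auto
  note IH = Suc.IH[OF this]
  have *: "b(i := b i - 1, i := (b(i := b i - 1)) i - e) = b(i := b i - Suc e)"
    by simp
  have "e \<le> (b(i := b i - 1)) i \<and> b i > 0 \<longleftrightarrow> Suc e \<le> b i"
    by auto
  then show ?case
    unfolding power_Suc mult.assoc mcoeff_var_mult[OF Suc.prems] IH * by (auto simp del: fun_upd_apply)
qed

lemma mcoeff_monomial:
  assumes "finite {i. b i \<noteq> 0}" "finite A"
  shows "mcoeff (\<Prod>i\<in>A. var i ^ e i) b = (if b = (\<lambda>i. if i \<in> A then e i else 0) then 1 else 0)"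
  using assms(2,1)
proof (induction A arbitrary: b rule: finite_induct)
  case empty
  then show ?case by (simp add: mcoeff_one)
next
  case (insert i A)
  have fin: "finite {j. (b(i := b i - e i)) j \<noteq> 0}"
    by (rule finite_subset[OF _ insert.prems]) auto
  have eq: "e i \<le> b i \<and> b(i := b i - e i) = (\<lambda>j. if j \<in> A then e j else 0) \<longleftrightarrow>
      b = (\<lambda>j. if j \<in> insert i A then e j else 0)"
    using insert.hyps by (auto simp: fun_eq_iff)
  show ?case
    unfolding prod.insert[OF insert.hyps] mcoeff_var_power_mult[OF insert.prems] insert.IH[OF fin]
      eq[symmetric]
    by (simp del: fun_upd_apply)
qed

text \<open>The Leibniz expansion of the determinant of the powers \<open>var j ^ \<beta> i\<close>
  with i, j < n.\<close>

definition alternant :: "nat \<Rightarrow> (nat \<Rightarrow> nat) \<Rightarrow> int mpoly" where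
  "alternant n \<beta> = (\<Sum>\<sigma> | \<sigma> permutes {..<n}. of_int (sign \<sigma>) * (\<Prod>i<n. var (\<sigma> i) ^ \<beta> i))"

lemma finite_supp:
  fixes b :: "nat \<Rightarrow> nat"
  assumes "\<And>i. i \<ge> n \<Longrightarrow> b i = 0"
  shows "finite {i. b i \<noteq> 0}"
proof (rule finite_subset)
  show "{i. b i \<noteq> 0} \<subseteq> {..<n}"
    by (rule subsetI, rule ccontr) (simp add: assms)
qed simp

lemma mcoeff_permuted_monomial:
  assumes \<sigma>: "\<sigma> permutes {..<n}" and b: "\<And>i. i \<ge> n \<Longrightarrow> b i = 0"
  shows "mcoeff (\<Prod>i<n. var (\<sigma> i) ^ \<beta> i) b = (if \<forall>i<n. b (\<sigma> i) = \<beta> i then 1 else 0)"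
proof -
  have inv: "inv \<sigma> (\<sigma> i) = i" "\<sigma> (inv \<sigma> i) = i" for i
    using \<sigma> by (auto simp: permutes_inverses)
  have lt: "\<sigma> i < n \<longleftrightarrow> i < n" for i
    using permutes_in_image[OF \<sigma>, of i] by simp
  have "(\<Prod>i<n. var (\<sigma> i) ^ \<beta> i) = (\<Prod>i<n. var i ^ \<beta> (inv \<sigma> i))"
    by (subst (2) prod.permute[OF \<sigma>]) (simp add: inv)
  moreover have "b = (\<lambda>i. if i \<in> {..<n} then \<beta> (inv \<sigma> i) else 0) \<longleftrightarrow> (\<forall>i<n. b (\<sigma> i) = \<beta> i)"
  proof
    assume "b = (\<lambda>i. if i \<in> {..<n} then \<beta> (inv \<sigma> i) else 0)"
    then show "\<forall>i<n. b (\<sigma> i) = \<beta> i"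
      using lt inv by simp
  next
    assume *: "\<forall>i<n. b (\<sigma> i) = \<beta> i"
    show "b = (\<lambda>i. if i \<in> {..<n} then \<beta> (inv \<sigma> i) else 0)"
    proof
      fix i
      show "b i = (if i \<in> {..<n} then \<beta> (inv \<sigma> i) else 0)"
        using b[of i] *[rule_format, of "inv \<sigma> i"] lt[of "inv \<sigma> i"] inv[of i] by auto
    qed
  qed
  ultimately show ?thesis
    using finite_supp[of n b, OF b] by (simp add: mcoeff_monomial)
qed

lemma mcoeff_alternant:
  assumes b: "\<And>i. i \<ge> n \<Longrightarrow> b i = 0"
  shows "mcoeff (alternant n \<beta>) b =
    (\<Sum>\<sigma> | \<sigma> permutes {..<n}. if \<forall>i<n. b (\<sigma> i) = \<beta> i then sign \<sigma> else 0)"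
  unfolding alternant_def mcoeff_sum mcoeff_of_int_mult
  by (intro sum.cong) (simp_all add: mcoeff_permuted_monomial b)

section \<open>Antisymmetric coefficients and the recursion over corners\<close>

definition var_sum :: "nat \<Rightarrow> int mpoly" where
  "var_sum n = (\<Sum>i<n. var i)"

lemma mcoeff_var_sum_mult:
  assumes "\<And>i. i \<ge> n \<Longrightarrow> b i = 0"
  shows "mcoeff (var_sum n * Q) b = (\<Sum>i | i < n \<and> b i > 0. mcoeff Q (b(i := b i - 1)))"
  using finite_supp[of n b, OF assms]
  by (simp add: var_sum_def sum_distrib_right mcoeff_sum mcoeff_var_mult sum.If_cases Int_def)

text \<open>A power of the symmetric \<open>var_sum n\<close> times an alternant is antisymmetric in
  the variables. The claim is proved on coefficients, with b general, since each further factor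
  lowers one entry of b.\<close>

lemma mcoeff_alternant_transpose:
  assumes "\<And>i. i \<ge> n \<Longrightarrow> b i = 0" "u < n" "v < n" "u \<noteq> v"
  shows "mcoeff (var_sum n ^ m * alternant n \<beta>) (b \<circ> transpose u v) = - mcoeff (var_sum n ^ m * alternant n \<beta>) b"
  using assms(1)
proof (induction m arbitrary: b)
  case 0
  let ?t = "transpose u v"
  have t: "?t permutes {..<n}"
    using assms(2,3) by (intro permutes_swap_id) auto
  have bt: "(b \<circ> ?t) i = 0" if "i \<ge> n" for i
    using that assms(2,3) 0 by (simp add: transpose_def)
  have "mcoeff (alternant n \<beta>) b =
      (\<Sum>\<sigma> | \<sigma> permutes {..<n}. if \<forall>i<n. b (\<sigma> i) = \<beta> i then sign \<sigma> else 0)"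
    using 0 by (rule mcoeff_alternant)
  also have "\<dots> = (\<Sum>\<sigma> | \<sigma> permutes {..<n}. if \<forall>i<n. b ((?t \<circ> \<sigma>) i) = \<beta> i then sign (?t \<circ> \<sigma>) else 0)"
    by (rule setum_permutations_compose_left[OF t])
  also have "\<dots> = (\<Sum>\<sigma> | \<sigma> permutes {..<n}. - (if \<forall>i<n. (b \<circ> ?t) (\<sigma> i) = \<beta> i then sign \<sigma> else 0))"
    using t assms(4)
    by (intro sum.cong) (auto simp: sign_compose permutes_imp_permutation[of "{..<n}"] sign_swap_id)
  also have "\<dots> = - mcoeff (alternant n \<beta>) (b \<circ> ?t)"
    unfolding sum_negf by (subst mcoeff_alternant) (use bt in simp_all)
  finally show ?case
    by (simp add: o_def)
next
  case (Suc m)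
  let ?t = "transpose u v" and ?Q = "var_sum n ^ m * alternant n \<beta>"
  have t: "?t i < n \<longleftrightarrow> i < n" for i
    using assms(2,3) by (auto simp: transpose_def)
  have bt: "(b \<circ> ?t) i = 0" if "i \<ge> n" for i
    using that assms(2,3) Suc.prems by (simp add: transpose_def)
  have "mcoeff (var_sum n * ?Q) (b \<circ> ?t) = (\<Sum>i | i < n \<and> (b \<circ> ?t) i > 0. mcoeff ?Q ((b \<circ> ?t)(i := (b \<circ> ?t) i - 1)))"
    by (rule mcoeff_var_sum_mult[OF bt])
  also have "\<dots> = (\<Sum>i | i < n \<and> b i > 0. mcoeff ?Q (b(i := b i - 1) \<circ> ?t))"
  proof (rule sum.reindex_bij_witness[where i = ?t and j = ?t])
    show "mcoeff ?Q (b(?t i := b (?t i) - 1) \<circ> ?t) = mcoeff ?Q ((b \<circ> ?t)(i := (b \<circ> ?t) i - 1))" for i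
      by (intro arg_cong[of _ _ "mcoeff ?Q"] ext) (auto simp: transpose_eq_iff)
  qed (auto simp: t)
  also have "\<dots> = (\<Sum>i | i < n \<and> b i > 0. - mcoeff ?Q (b(i := b i - 1)))"
    using Suc.prems by (intro sum.cong refl Suc.IH) auto
  also have "\<dots> = - mcoeff (var_sum n * ?Q) b"
    using Suc.prems by (simp add: mcoeff_var_sum_mult sum_negf)
  finally show ?case
    by (simp only: power_Suc mult.assoc)
qed

text \<open>The transposition fixes b, so this integer coefficient equals its own negative.\<close>

lemma mcoeff_alternant_repeated:
  assumes "\<And>i. i \<ge> n \<Longrightarrow> b i = 0" "u < n" "v < n" "u \<noteq> v" "b u = b v"
  shows "mcoeff (var_sum n ^ m * alternant n \<beta>) b = 0"
proof -
  have "b \<circ> transpose u v = b"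
    using assms(5) by (auto simp: transpose_def fun_eq_iff)
  then show ?thesis
    using mcoeff_alternant_transpose[of n b u v m \<beta>, OF assms(1-4)] by simp
qed

text \<open>The vector \<delta> = (n-1, ..., 1, 0); adding it makes the exponents of a partition
  with at most n parts strictly decreasing.\<close>

definition staircase :: "nat \<Rightarrow> nat \<Rightarrow> nat" where
  "staircase n i = (if i < n then n - 1 - i else 0)"

text \<open>Multiplying by \<open>var_sum n\<close> lowers one entry of \<mu>+\<delta>. In a row
  that is not a corner, the lowered entry collides with the next one and the coefficient vanishes.
  This recursion is shared by standard tableaux and Pieri's rule.\<close>

lemma mcoeff_alternant_corners:
  assumes part: "is_partition \<mu>" and supp: "\<And>i. i \<ge> n \<Longrightarrow> \<mu> i = 0"
  shows "mcoeff (var_sum n ^ Suc m * alternant n \<beta>) (\<lambda>i. \<mu> i + staircase n i) =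
    (\<Sum>i\<in>corners \<mu>. mcoeff (var_sum n ^ m * alternant n \<beta>) (\<lambda>j. (\<mu>(i := \<mu> i - 1)) j + staircase n j))"
proof -
  let ?Q = "var_sum n ^ m * alternant n \<beta>" and ?b = "\<lambda>i. \<mu> i + staircase n i"
  have b: "?b i = 0" if "i \<ge> n" for i
    using that supp by (simp add: staircase_def)
  have sub: "corners \<mu> \<subseteq> {i. i < n \<and> ?b i > 0}"
    using supp by (auto simp: corners_def) (metis leI not_less_zero)
  have zero: "mcoeff ?Q (?b(i := ?b i - 1)) = 0" if "i < n" "?b i > 0" "i \<notin> corners \<mu>" for i
  proof (rule mcoeff_alternant_repeated[of n _ i "Suc i"])
    have eq: "\<mu> (Suc i) = \<mu> i"
      using that(3) partition_Suc_le[OF part, of i] by (simp add: corners_def)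
    \<comment> \<open>If i were the last row and no corner, its entry in \<mu>+\<delta> would be 0,
      leaving nothing to lower.\<close>
    show "Suc i < n"
    proof (rule ccontr)
      assume "\<not> Suc i < n"
      then have "\<mu> i = 0" "staircase n i = 0"
        using eq supp[of "Suc i"] by (auto simp: staircase_def)
      then show False
        using that(2) by simp
    qed
    then show "(?b(i := ?b i - 1)) i = (?b(i := ?b i - 1)) (Suc i)"
      using eq by (simp add: staircase_def)
  qed (use that b in auto)
  have "mcoeff (var_sum n * ?Q) ?b = (\<Sum>i | i < n \<and> ?b i > 0. mcoeff ?Q (?b(i := ?b i - 1)))"
    by (rule mcoeff_var_sum_mult[OF b])
  also have "\<dots> = (\<Sum>i\<in>corners \<mu>. mcoeff ?Q (?b(i := ?b i - 1)))"
    using sub zero by (intro sum.mono_neutral_right) auto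
  also have "\<dots> = (\<Sum>i\<in>corners \<mu>. mcoeff ?Q (\<lambda>j. (\<mu>(i := \<mu> i - 1)) j + staircase n j))"
    by (intro sum.cong refl arg_cong[of _ _ "mcoeff ?Q"] ext) (auto simp: corners_def)
  finally show ?thesis
    by (simp add: mult.assoc)
qed

section \<open>Strictly decreasing exponents and the Frobenius expression for
  \<open>num_SYT\<close>\<close>

lemma permutes_strict_antimono_eq_id:
  fixes b c :: "nat \<Rightarrow> nat"
  assumes \<sigma>: "\<sigma> permutes {..<n}" and bc: "\<forall>i<n. b (\<sigma> i) = c i"
    and b: "\<And>i j. i < j \<Longrightarrow> j < n \<Longrightarrow> b j < b i" and c: "\<And>i j. i < j \<Longrightarrow> j < n \<Longrightarrow> c j < c i"
  shows "\<sigma> = id"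
proof -
  have lt: "\<sigma> i < n" if "i < n" for i
    using permutes_in_image[OF \<sigma>, of i] that by simp
  have mono: "\<sigma> i < \<sigma> j" if "i < j" "j < n" for i j
  proof (rule ccontr)
    assume "\<not> \<sigma> i < \<sigma> j"
    then have "b (\<sigma> i) \<le> b (\<sigma> j)"
      using b[of "\<sigma> j" "\<sigma> i"] lt[of i] that by (cases "\<sigma> i = \<sigma> j") auto
    then show False
      using bc c[OF that] that by simp
  qed
  \<comment> \<open>Both sequences decrease strictly, so \<sigma> is increasing and cannot move any
    index down; for a permutation of an initial segment this forces the identity.\<close>
  have "i \<le> \<sigma> i" if "i < n" for i
    using that
  proof (induction i)
    case (Suc i)
    then show ?case
      using mono[of i "Suc i"] by simp
  qed simp
  then show ?thesis
    using permutes_natset_ge[OF \<sigma>] by simp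
qed

lemma mcoeff_alternant_sorted:
  assumes b0: "\<And>i. i \<ge> n \<Longrightarrow> b i = 0"
    and b: "\<And>i j. i < j \<Longrightarrow> j < n \<Longrightarrow> b j < b i" and \<beta>: "\<And>i j. i < j \<Longrightarrow> j < n \<Longrightarrow> \<beta> j < \<beta> i"
  shows "mcoeff (alternant n \<beta>) b = (if \<forall>i<n. b i = \<beta> i then 1 else 0)"
proof -
  have eq: "(if \<forall>i<n. b (\<sigma> i) = \<beta> i then sign \<sigma> else 0) =
      (if \<sigma> = id then if \<forall>i<n. b i = \<beta> i then 1 else 0 else 0)"
    if "\<sigma> permutes {..<n}" for \<sigma>
    using permutes_strict_antimono_eq_id[of \<sigma> n b \<beta>, OF that _ b \<beta>] by auto
  have "mcoeff (alternant n \<beta>) b =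
      (\<Sum>\<sigma> | \<sigma> permutes {..<n}. if \<forall>i<n. b (\<sigma> i) = \<beta> i then sign \<sigma> else 0)"
    using b0 by (rule mcoeff_alternant)
  also have "\<dots> = (\<Sum>\<sigma> | \<sigma> permutes {..<n}. if \<sigma> = id then if \<forall>i<n. b i = \<beta> i then 1 else 0 else 0)"
    by (intro sum.cong refl eq) simp
  also have "\<dots> = (if \<forall>i<n. b i = \<beta> i then 1 else 0)"
    by (simp add: sum.delta finite_permutations permutes_id)
  finally show ?thesis .
qed

lemma add_staircase_strict:
  assumes "is_partition \<mu>" "i < j" "j < n"
  shows "\<mu> j + staircase n j < \<mu> i + staircase n i"
  using partition_antimono[OF assms(1), of i j] assms(2,3) by (simp add: staircase_def)

lemma mcoeff_uminus [simp]: "mcoeff (- Q) b = - mcoeff Q b"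
  by (simp add: mcoeff_def)

text \<open>Both sides satisfy the same recursion over corners, \<open>num_SYT_rec\<close> and
  \<open>mcoeff_alternant_corners\<close>, and both are 1 for the empty shape.\<close>

lemma num_SYT_eq_mcoeff:
  assumes "is_partition \<mu>" "\<And>i. i \<ge> n \<Longrightarrow> \<mu> i = 0"
  shows "int (num_SYT \<mu>) =
    mcoeff (var_sum n ^ psize \<mu> * alternant n (staircase n)) (\<lambda>i. \<mu> i + staircase n i)"
  using assms
proof (induction "psize \<mu>" arbitrary: \<mu>)
  case 0
  then have \<mu>: "\<mu> = (\<lambda>_. 0)"
    by (simp add: psize_eq_0_iff)
  have "mcoeff (alternant n (staircase n)) (\<lambda>i. \<mu> i + staircase n i) = 1"
    by (subst mcoeff_alternant_sorted) (auto simp: \<mu> staircase_def)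
  with 0 show ?case
    by (simp add: \<mu> num_SYT_empty)
next
  case (Suc N)
  have IH: "int (num_SYT (\<mu>(i := \<mu> i - 1))) =
      mcoeff (var_sum n ^ N * alternant n (staircase n)) (\<lambda>j. (\<mu>(i := \<mu> i - 1)) j + staircase n j)"
    if "i \<in> corners \<mu>" for i
  proof -
    have "N = psize (\<mu>(i := \<mu> i - 1))"
      using psize_del_box[OF Suc.prems(1) that] Suc.hyps(2) by simp
    moreover have "(\<mu>(i := \<mu> i - 1)) j = 0" if "j \<ge> n" for j
      using Suc.prems(2)[OF that] by (cases "j = i") auto
    ultimately show ?thesis
      using Suc.hyps(1) partition_del_box[OF Suc.prems(1) that] by metis
  qed
  have "int (num_SYT \<mu>) = (\<Sum>i\<in>corners \<mu>. int (num_SYT (\<mu>(i := \<mu> i - 1))))"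
    using num_SYT_rec[OF Suc.prems(1)] Suc.hyps(2) by simp
  also have "\<dots> = (\<Sum>i\<in>corners \<mu>. mcoeff (var_sum n ^ N * alternant n (staircase n))
      (\<lambda>j. (\<mu>(i := \<mu> i - 1)) j + staircase n j))"
    by (intro sum.cong refl IH)
  also have "\<dots> = mcoeff (var_sum n ^ Suc N * alternant n (staircase n)) (\<lambda>i. \<mu> i + staircase n i)"
    using Suc.prems by (intro mcoeff_alternant_corners[symmetric])
  finally show ?case
    using Suc.hyps(2) by simp
qed

subsection \<open>Expansion in Schur polynomials\<close>

definition partitions :: "nat \<Rightarrow> nat \<Rightarrow> (nat \<Rightarrow> nat) set" where
  "partitions n N = {\<mu>. is_partition \<mu> \<and> psize \<mu> = N \<and> (\<forall>i\<ge>n. \<mu> i = 0)}"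

lemma partitions_is_partition: "\<mu> \<in> partitions n N \<Longrightarrow> is_partition \<mu>"
  by (simp add: partitions_def)

lemma finite_partitions_of: "finite (partitions n N)"
  by (rule finite_subset[OF _ finite_partitions[of N "Suc n"]])
    (auto simp: partitions_def plen_le_iff less_Suc_eq_le)

text \<open>Induction on m: Pieri's rule adds one box, so the new coefficient of s_\<mu> sums the
  old ones over the corners of \<mu>, exactly as in \<open>mcoeff_alternant_corners\<close>. For m =
  0 the alternant has a single strictly decreasing exponent vector.\<close>

lemma pieri_power:
  assumes "n > 0"
  shows "(\<Sum>j=1..n. y j) ^ m * schur n (one_row r) y =
    (\<Sum>\<mu>\<in>partitions n (m + r). of_int (mcoeff (var_sum n ^ m *
      alternant n (\<lambda>i. one_row r i + staircase n i)) (\<lambda>i. \<mu> i + staircase n i)) * schur n \<mu> y)"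
proof (induction m)
  case 0
  have "mcoeff (alternant n (\<lambda>i. one_row r i + staircase n i)) (\<lambda>i. \<mu> i + staircase n i) =
      (if \<mu> = one_row r then 1 else 0)" if \<mu>: "\<mu> \<in> partitions n r" for \<mu>
  proof -
    have "(\<forall>i<n. \<mu> i + staircase n i = one_row r i + staircase n i) \<longleftrightarrow> \<mu> = one_row r"
    proof
      assume *: "\<forall>i<n. \<mu> i + staircase n i = one_row r i + staircase n i"
      have "\<mu> i = one_row r i" for i
        using * \<mu> assms by (cases "i < n") (auto simp: partitions_def one_row_def)
      then show "\<mu> = one_row r"
        by blast
    qed auto
    moreover have "is_partition \<mu>" "\<And>i. i \<ge> n \<Longrightarrow> \<mu> i + staircase n i = 0"
      using \<mu> by (auto simp: partitions_def staircase_def)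
    ultimately show ?thesis
      by (subst mcoeff_alternant_sorted) (auto intro: add_staircase_strict)
  qed
  then have "(\<Sum>\<mu>\<in>partitions n r. of_int (mcoeff (alternant n (\<lambda>i. one_row r i + staircase n i))
      (\<lambda>i. \<mu> i + staircase n i)) * schur n \<mu> y) =
      (\<Sum>\<mu>\<in>partitions n r. if \<mu> = one_row r then schur n \<mu> y else 0)"
    by (intro sum.cong) auto
  \<comment> \<open>Since n > 0, the single row fits into n rows.\<close>
  also have "one_row r \<in> partitions n r"
    using assms by (simp add: partitions_def) (simp add: one_row_def)
  then have "(\<Sum>\<mu>\<in>partitions n r. if \<mu> = one_row r then schur n \<mu> y else 0) = schur n (one_row r) y"
    by (simp add: sum.delta' finite_partitions_of)
  finally show ?case
    by simp
next
  case (Suc m)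
  let ?add = "\<lambda>\<nu> i. \<nu>(i := Suc (\<nu> i :: nat)) :: nat \<Rightarrow> nat"
    and ?del = "\<lambda>\<nu> i. \<nu>(i := \<nu> i - 1 :: nat) :: nat \<Rightarrow> nat"
  define c where "c m \<mu> = mcoeff (var_sum n ^ m * alternant n (\<lambda>i. one_row r i + staircase n i))
      (\<lambda>i. \<mu> i + staircase n i)" for m \<mu>
  let ?A = "\<lambda>\<nu>. {i. i < n \<and> is_partition (?add \<nu> i)}"
  have pieri: "(\<Sum>j=1..n. y j) * schur n \<nu> y = (\<Sum>i\<in>?A \<nu>. schur n (?add \<nu> i) y)"
    if \<nu>: "\<nu> \<in> partitions n N" for \<nu> N
  proof -
    have "(\<Sum>j=1..n. y j) * schur n \<nu> y = (\<Sum>i | i \<le> n \<and> is_partition (?add \<nu> i). schur n (?add \<nu> i) y)"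
      using \<nu> by (intro schur_pieri_box) (auto simp: partitions_def)
    also have "\<dots> = (\<Sum>i\<in>?A \<nu>. schur n (?add \<nu> i) y)"
    proof (rule sum.mono_neutral_right)
      \<comment> \<open>A box added in row n gives n+1 nonempty rows, too many for n
        variables.\<close>
      show "\<forall>i\<in>{i. i \<le> n \<and> is_partition (?add \<nu> i)} - ?A \<nu>. schur n (?add \<nu> i) y = 0"
      proof
        fix i assume "i \<in> {i. i \<le> n \<and> is_partition (?add \<nu> i)} - ?A \<nu>"
        then have "i = n" "is_partition (?add \<nu> i)"
          by auto
        then show "schur n (?add \<nu> i) y = 0"
          by (intro schur_too_many_rows) auto
      qed
    qed auto
    finally show ?thesis .
  qed
  have add: "?add \<nu> i \<in> partitions n (Suc N)" "i \<in> corners (?add \<nu> i)"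
    if "\<nu> \<in> partitions n N" "i < n" "is_partition (?add \<nu> i)" for \<nu> i N
    using that partition_Suc_le[of \<nu> i] psize_add_box[of \<nu> i]
    by (auto simp: partitions_def corners_def)
  have del: "?del \<mu> i \<in> partitions n N \<and> i < n \<and> is_partition \<mu> \<and> \<mu> i > 0"
    if "\<mu> \<in> partitions n (Suc N)" "i \<in> corners \<mu>" for \<mu> i N
  proof -
    have "\<mu> i > 0"
      using that(2) by (auto simp: corners_def)
    moreover from this have "i < n"
      using that(1) by (auto simp: partitions_def) (metis leI less_numeral_extra(3))
    ultimately show ?thesis
      using that partition_del_box[of \<mu> i] psize_del_box[of \<mu> i] by (auto simp: partitions_def)
  qed
  have "(\<Sum>j=1..n. y j) ^ Suc m * schur n (one_row r) y =
      (\<Sum>j=1..n. y j) * (\<Sum>\<nu>\<in>partitions n (m + r). of_int (c m \<nu>) * schur n \<nu> y)"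
    unfolding power_Suc mult.assoc Suc.IH c_def ..
  also have "\<dots> = (\<Sum>\<nu>\<in>partitions n (m + r). of_int (c m \<nu>) * ((\<Sum>j=1..n. y j) * schur n \<nu> y))"
    unfolding sum_distrib_left[of "\<Sum>j=1..n. y j"] by (intro sum.cong refl mult.left_commute)
  also have "\<dots> = (\<Sum>\<nu>\<in>partitions n (m + r). \<Sum>i\<in>?A \<nu>. of_int (c m \<nu>) * schur n (?add \<nu> i) y)"
    by (intro sum.cong refl) (simp only: pieri sum_distrib_left)
  also have "\<dots> = (\<Sum>(\<nu>, i)\<in>Sigma (partitions n (m + r)) ?A. of_int (c m \<nu>) * schur n (?add \<nu> i) y)"
    by (rule sum.Sigma) (auto simp: finite_partitions_of)
  \<comment> \<open>A shape with an addable box is the same datum as the enlarged shape with a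
    corner.\<close>
  also have "\<dots> = (\<Sum>(\<mu>, i)\<in>Sigma (partitions n (Suc m + r)) corners. of_int (c m (?del \<mu> i)) * schur n \<mu> y)"
    by (rule sum.reindex_bij_witness
        [where j = "\<lambda>(\<nu>, i). (?add \<nu> i, i)" and i = "\<lambda>(\<mu>, i). (?del \<mu> i, i)"])
      (auto simp: add dest: del)
  also have "\<dots> = (\<Sum>\<mu>\<in>partitions n (Suc m + r). \<Sum>i\<in>corners \<mu>. of_int (c m (?del \<mu> i)) * schur n \<mu> y)"
    by (rule sum.Sigma[symmetric]) (auto simp: finite_partitions_of intro: finite_corners partitions_is_partition)
  also have "\<dots> = (\<Sum>\<mu>\<in>partitions n (Suc m + r). of_int (c (Suc m) \<mu>) * schur n \<mu> y)"
  proof (rule sum.cong[OF refl])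
    fix \<mu> assume "\<mu> \<in> partitions n (Suc m + r)"
    then have "c (Suc m) \<mu> = (\<Sum>i\<in>corners \<mu>. c m (?del \<mu> i))"
      unfolding c_def by (intro mcoeff_alternant_corners) (auto simp: partitions_def)
    then show "(\<Sum>i\<in>corners \<mu>. of_int (c m (?del \<mu> i)) * schur n \<mu> y) = of_int (c (Suc m) \<mu>) * schur n \<mu> y"
      by (simp add: sum_distrib_right)
  qed
  finally show ?case
    unfolding c_def .
qed

section \<open>Permuting exponents, and alternants whose last exponent varies\<close>

lemma alternant_permute:
  assumes \<tau>: "\<tau> permutes {..<n}"
  shows "alternant n (\<beta> \<circ> \<tau>) = of_int (sign \<tau>) * alternant n \<beta>"
proof -
  have "of_int (sign (\<sigma> \<circ> \<tau>)) * (\<Prod>i<n. var ((\<sigma> \<circ> \<tau>) i) ^ (\<beta> \<circ> \<tau>) i) =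
      of_int (sign \<tau>) * (of_int (sign \<sigma>) * (\<Prod>i<n. var (\<sigma> i) ^ \<beta> i))" if "\<sigma> permutes {..<n}" for \<sigma>
  proof -
    have "(\<Prod>i<n. var ((\<sigma> \<circ> \<tau>) i) ^ (\<beta> \<circ> \<tau>) i) = (\<Prod>i<n. var (\<sigma> i) ^ \<beta> i)"
      by (subst (2) prod.permute[OF \<tau>]) (simp add: o_def)
    moreover have "sign (\<sigma> \<circ> \<tau>) = sign \<sigma> * sign \<tau>"
      using that \<tau> by (intro sign_compose permutes_imp_permutation[of "{..<n}"]) auto
    ultimately show ?thesis
      by (simp add: mult_ac)
  qed
  then show ?thesis
    unfolding alternant_def sum_distrib_left
    by (subst sum_permutations_compose_right[OF \<tau>]) (intro sum.cong, auto)
qed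

text \<open>A determinant with two equal rows: swapping them negates the product, so each integer
  coefficient vanishes.\<close>

lemma mcoeff_alternant_repeated_exponent:
  assumes "u < n" "v < n" "u \<noteq> v" "\<beta> u = \<beta> v"
  shows "mcoeff (P * alternant n \<beta>) b = 0"
proof -
  have "\<beta> \<circ> transpose u v = \<beta>"
    using assms(4) by (auto simp: transpose_def fun_eq_iff)
  moreover have "transpose u v permutes {..<n}"
    using assms by (intro permutes_swap_id) auto
  ultimately have "P * alternant n \<beta> = - (P * alternant n \<beta>)"
    using alternant_permute[of "transpose u v" n \<beta>] assms(3) by (simp add: sign_swap_id)
  then have "mcoeff (P * alternant n \<beta>) b = - mcoeff (P * alternant n \<beta>) b"
    by (metis mcoeff_uminus)
  then show ?thesis
    by simp
qed

text \<open>The cycle 0, 1, ..., m; composing an exponent vector with it moves the first exponent to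
  position m.\<close>

definition cyc :: "nat \<Rightarrow> nat \<Rightarrow> nat" where
  "cyc m i = (if i < m then Suc i else if i = m then 0 else i)"

lemma cyc_Suc: "cyc (Suc m) = transpose 0 (Suc m) \<circ> cyc m"
  by (auto simp: cyc_def transpose_def fun_eq_iff)

lemma cyc_permutes_sign: "cyc m permutes {..<Suc m} \<and> sign (cyc m) = (- 1) ^ m"
proof (induction m)
  case 0
  have "cyc 0 = id"
    by (auto simp: cyc_def)
  then show ?case
    by (simp only: permutes_id sign_id power_0 simp_thms)
next
  case (Suc m)
  have t: "transpose 0 (Suc m) permutes {..<Suc (Suc m)}"
    by (intro permutes_swap_id) auto
  have c: "cyc m permutes {..<Suc (Suc m)}"
    using Suc.IH by (auto intro: permutes_subset)
  have "permutation (transpose 0 (Suc m))" "permutation (cyc m)"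
    using t c by (auto intro: permutes_imp_permutation[of "{..<Suc (Suc m)}"])
  then have "sign (cyc (Suc m)) = (- 1) ^ Suc m"
    using Suc.IH by (simp add: cyc_Suc sign_compose sign_swap_id)
  with permutes_compose[OF c t] show ?case
    unfolding cyc_Suc by blast
qed

text \<open>The exponents (r+m, m-1, ..., 0) are rotated to (m-1, ..., 0, r+m), so that r occurs
  only in the last position.\<close>

lemma alternant_last_exponent:
  "alternant (Suc m) ((staircase m)(m := r + m)) =
    (- 1) ^ m * alternant (Suc m) (\<lambda>i. one_row r i + staircase (Suc m) i)"
proof -
  have "(staircase m)(m := r + m) = (\<lambda>i. one_row r i + staircase (Suc m) i) \<circ> cyc m"
    by (auto simp: fun_eq_iff staircase_def one_row_def cyc_def)
  then show ?thesis
    using alternant_permute[of "cyc m" "Suc m"] cyc_permutes_sign[of m] by simp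
qed

text \<open>For fixed \<sigma>, only the power of \<open>var (\<sigma> m)\<close> depends on s.
  Exchanging the sums therefore leaves a binomial expansion for each \<sigma>.\<close>

lemma sum_alternant_last_exponent:
  "(\<Sum>s\<le>N. of_int ((- 1) ^ s * int (N choose s)) *
      (var_sum (Suc m) ^ (N - s) * alternant (Suc m) ((staircase m)(m := s)))) =
    (\<Sum>\<sigma> | \<sigma> permutes {..<Suc m}. of_int (sign \<sigma>) *
      ((var_sum (Suc m) - var (\<sigma> m)) ^ N * (\<Prod>i<m. var (\<sigma> i) ^ staircase m i)))"
proof -
  let ?p = "var_sum (Suc m)" and ?M = "\<lambda>\<sigma>. \<Prod>i<m. var (\<sigma> i) ^ staircase m i"
  have alt: "alternant (Suc m) ((staircase m)(m := s)) =
      (\<Sum>\<sigma> | \<sigma> permutes {..<Suc m}. of_int (sign \<sigma>) * (?M \<sigma> * var (\<sigma> m) ^ s))" for s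
    unfolding alternant_def by (intro sum.cong) auto
  have pow: "(?p - var j) ^ N =
      (\<Sum>s\<le>N. of_int ((- 1) ^ s * int (N choose s)) * (?p ^ (N - s) * var j ^ s))" for j
    using binomial_ring[of "- var j" ?p N] by (simp add: power_minus[of "var j"] mult_ac)
  have "(\<Sum>s\<le>N. of_int ((- 1) ^ s * int (N choose s)) *
      (?p ^ (N - s) * (of_int (sign \<sigma>) * (?M \<sigma> * var (\<sigma> m) ^ s)))) =
      of_int (sign \<sigma>) * ((?p - var (\<sigma> m)) ^ N * ?M \<sigma>)" for \<sigma>
    unfolding pow sum_distrib_right sum_distrib_left[of "of_int (sign \<sigma>)"]
    by (intro sum.cong refl) (simp only: mult_ac)
  then show ?thesis
    unfolding alt sum_distrib_left by (subst sum.swap) simp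
qed

text \<open>If variable j does not occur in Q, multiplication by variables from A cannot introduce
  it.\<close>

lemma mcoeff_avoids_var:
  assumes Q: "\<And>c. finite {i. c i \<noteq> 0} \<Longrightarrow> c j > 0 \<Longrightarrow> mcoeff Q c = 0"
    and A: "j \<notin> A" "finite {i. b i \<noteq> 0}" "b j > 0"
  shows "mcoeff ((\<Sum>i\<in>A. var i) ^ N * Q) b = 0"
  using A(2,3)
proof (induction N arbitrary: b)
  case 0
  then show ?case
    using Q by simp
next
  case (Suc N)
  have "mcoeff ((\<Sum>i\<in>A. var i) ^ N * Q) (b(i := b i - 1)) = 0" if "i \<in> A" for i
  proof (rule Suc.IH)
    show "finite {k. (b(i := b i - 1)) k \<noteq> 0}"
      by (rule finite_subset[OF _ Suc.prems(1)]) auto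
    show "(b(i := b i - 1)) j > 0"
      using that A(1) Suc.prems(2) by auto
  qed
  then show ?case
    unfolding power_Suc mult.assoc
    unfolding sum_distrib_right[of var] mcoeff_sum mcoeff_var_mult[OF Suc.prems(1)]
    by (auto intro!: sum.neutral)
qed

text \<open>Subtracting \<open>var (\<sigma> m)\<close> removes this variable from the sum, and
  injectivity of \<sigma> keeps it out of the monomial.\<close>

lemma mcoeff_last_exponent_term:
  assumes \<sigma>: "\<sigma> permutes {..<Suc m}" and b: "\<And>i. i > m \<Longrightarrow> b i = 0" and pos: "b (\<sigma> m) > 0"
  shows "mcoeff ((var_sum (Suc m) - var (\<sigma> m)) ^ N * (\<Prod>i<m. var (\<sigma> i) ^ staircase m i)) b = 0"
proof -
  have inj: "inj_on \<sigma> A" for A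
    using permutes_inj[OF \<sigma>] by (rule inj_on_subset) simp
  have \<sigma>m: "\<sigma> m < Suc m"
    using permutes_in_image[OF \<sigma>, of m] by simp
  have "mcoeff (\<Prod>i<m. var (\<sigma> i) ^ staircase m i) c = 0"
    if "finite {i. c i \<noteq> 0}" "c (\<sigma> m) > 0" for c
  proof -
    have "(\<Prod>i<m. var (\<sigma> i) ^ staircase m i) = (\<Prod>k\<in>\<sigma> ` {..<m}. var k ^ staircase m (inv \<sigma> k))"
      using permutes_inverses[OF \<sigma>] by (simp add: prod.reindex inj)
    moreover have "\<sigma> m \<notin> \<sigma> ` {..<m}"
      using permutes_inj[OF \<sigma>] by (auto dest: injD)
    ultimately show ?thesis
      using that by (auto simp: mcoeff_monomial)
  qed
  moreover have "var_sum (Suc m) - var (\<sigma> m) = (\<Sum>i\<in>{..<Suc m} - {\<sigma> m}. var i)"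
    using \<sigma>m by (simp add: var_sum_def sum_diff1 del: sum.lessThan_Suc)
  moreover have "finite {i. b i \<noteq> 0}"
    using b by (intro finite_supp[of "Suc m"]) auto
  ultimately show ?thesis
    using pos by (simp only:) (rule mcoeff_avoids_var, auto)
qed

text \<open>Here n = m+1. With s = r+m, symmetry of binomials gives k+m over s, and the sign of the
  rotation completes (-1)^s. The sum thus becomes the part s \<ge> m of
  \<open>sum_alternant_last_exponent\<close> with N = k+m.\<close>

lemma sum_mcoeff_alternant:
  assumes \<mu>: "\<mu> \<in> partitions (Suc m) k"
  shows "(\<Sum>r\<le>k. (- 1) ^ r * int ((k + m) choose (k - r)) *
      mcoeff (var_sum (Suc m) ^ (k - r) * alternant (Suc m) (\<lambda>i. one_row r i + staircase (Suc m) i))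
        (\<lambda>i. \<mu> i + staircase (Suc m) i)) =
    (if \<mu> m = 0 then int (num_SYT (\<lambda>i. \<mu> i + one_column m i)) else 0)"
proof -
  let ?p = "var_sum (Suc m)" and ?M = "\<lambda>\<sigma>. \<Prod>i<m. var (\<sigma> i) ^ staircase m i"
  let ?S = "{\<sigma>. \<sigma> permutes {..<Suc m}}"
  define b where "b = (\<lambda>i. \<mu> i + staircase (Suc m) i)"
  define t where "t s = (- 1) ^ s * int ((k + m) choose s) *
      mcoeff (?p ^ (k + m - s) * alternant (Suc m) ((staircase m)(m := s))) b" for s
  have part: "is_partition \<mu>" and size: "psize \<mu> = k" and supp: "\<And>i. i > m \<Longrightarrow> \<mu> i = 0"
    using \<mu> by (auto simp: partitions_def)
  have b0: "b i = 0" if "i > m" for i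
    using supp that by (simp add: b_def staircase_def)
  have b_pos: "b i > 0" if "i < m" for i
    using that by (simp add: b_def staircase_def)
  \<comment> \<open>An exponent s < m already occurs at position m-1-s of the staircase; this allows
    the sum to be completed down to s = 0.\<close>
  have t0: "t s = 0" if "s < m" for s
    unfolding t_def using that
    by (subst mcoeff_alternant_repeated_exponent[of m _ "m - 1 - s"]) (auto simp: staircase_def)
  have "(\<Sum>r\<le>k. (- 1) ^ r * int ((k + m) choose (k - r)) *
      mcoeff (?p ^ (k - r) * alternant (Suc m) (\<lambda>i. one_row r i + staircase (Suc m) i)) b) =
      (\<Sum>r\<le>k. t (r + m))"
  proof (rule sum.cong[OF refl])
    fix r assume "r \<in> {..k}"
    then have *: "(k + m) choose (r + m) = (k + m) choose (k - r)" "k + m - (r + m) = k - r"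
      using binomial_symmetric[of "r + m" "k + m"] by auto
    have "mcoeff (?p ^ (k - r) * ((- 1) ^ m * alternant (Suc m) (\<lambda>i. one_row r i + staircase (Suc m) i))) b =
        (- 1) ^ m * mcoeff (?p ^ (k - r) * alternant (Suc m) (\<lambda>i. one_row r i + staircase (Suc m) i)) b"
      by (cases "even m") simp_all
    then show "(- 1) ^ r * int ((k + m) choose (k - r)) *
        mcoeff (?p ^ (k - r) * alternant (Suc m) (\<lambda>i. one_row r i + staircase (Suc m) i)) b = t (r + m)"
      unfolding t_def alternant_last_exponent * by (simp add: power_add)
  qed
  also have "\<dots> = (\<Sum>s\<in>{m..k + m}. t s)"
    by (rule sum.reindex_bij_witness[where i = "\<lambda>s. s - m" and j = "\<lambda>r. r + m"]) auto
  also have "\<dots> = (\<Sum>s\<le>k + m. t s)"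
    using t0 by (intro sum.mono_neutral_left) auto
  also have "\<dots> = mcoeff (\<Sum>s\<le>k + m. of_int ((- 1) ^ s * int ((k + m) choose s)) *
      (?p ^ (k + m - s) * alternant (Suc m) ((staircase m)(m := s)))) b"
    by (simp only: mcoeff_sum mcoeff_of_int_mult t_def)
  also have "\<dots> = (\<Sum>\<sigma>\<in>?S. sign \<sigma> * mcoeff ((?p - var (\<sigma> m)) ^ (k + m) * ?M \<sigma>) b)"
    by (simp only: sum_alternant_last_exponent mcoeff_sum mcoeff_of_int_mult)
  also have "\<dots> = (if \<mu> m = 0 then int (num_SYT (\<lambda>i. \<mu> i + one_column m i)) else 0)"
  proof (cases "\<mu> m = 0")
    case False
    \<comment> \<open>Now all of b 0, ..., b m are positive, so whichever variable a term lacks is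
      one that b requires.\<close>
    have "mcoeff ((?p - var (\<sigma> m)) ^ (k + m) * ?M \<sigma>) b = 0" if "\<sigma> \<in> ?S" for \<sigma>
    proof (rule mcoeff_last_exponent_term)
      have "\<sigma> m < Suc m"
        using permutes_in_image[of \<sigma> "{..<Suc m}" m] that by simp
      then show "b (\<sigma> m) > 0"
        using b_pos[of "\<sigma> m"] False by (cases "\<sigma> m = m") (auto simp: b_def)
    qed (use that b0 in auto)
    with False show ?thesis
      by simp
  next
    case True
    let ?T = "{\<sigma>. \<sigma> permutes {..<m}}" and ?\<mu> = "\<lambda>i. \<mu> i + one_column m i"
    have supp': "?\<mu> i = 0" if "i \<ge> m" for i
      using that True supp[of i] by (cases "i = m") (auto simp: one_column_def)
    have psize': "psize ?\<mu> = k + m"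
    proof -
      have "psize ?\<mu> = (\<Sum>i<m. \<mu> i + 1)"
        using supp' by (subst psize_eq_sum[of m]) (auto simp: one_column_def)
      also have "\<dots> = (\<Sum>i<Suc m. \<mu> i) + m"
        unfolding sum.distrib using True by simp
      also have "(\<Sum>i<Suc m. \<mu> i) = k"
        using supp size by (subst psize_eq_sum[symmetric]) auto
      finally show ?thesis .
    qed
    \<comment> \<open>The staircase for m+1 exceeds the one for m by 1 in each of the first m
      positions. This surplus is the added column in the shape \<mu> + (1^m).\<close>
    have b_eq: "b = (\<lambda>i. ?\<mu> i + staircase m i)"
    proof
      fix i
      show "b i = ?\<mu> i + staircase m i"
        using True supp[of i] by (cases i m rule: linorder_cases)
          (auto simp: b_def staircase_def one_column_def)
    qed
    have sub: "?T \<subseteq> ?S"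
      by (auto intro: permutes_subset)
    \<comment> \<open>A permutation that moves m has \<open>\<sigma> m < m\<close>, where b is
      positive; only those fixing m survive, and for them the power is that of
      \<open>var_sum m\<close>.\<close>
    have "mcoeff ((?p - var (\<sigma> m)) ^ (k + m) * ?M \<sigma>) b = 0" if "\<sigma> \<in> ?S - ?T" for \<sigma>
    proof (rule mcoeff_last_exponent_term)
      have "\<sigma> m \<noteq> m"
      proof
        assume *: "\<sigma> m = m"
        have "\<sigma> permutes {..<m}"
        proof (rule permutes_superset)
          show "\<sigma> permutes {..<Suc m}"
            using that by simp
          show "\<sigma> i = i" if "i \<in> {..<Suc m} - {..<m}" for i
            using that * by (auto simp: less_Suc_eq)
        qed
        then show False
          using that by simp
      qed
      moreover have "\<sigma> m < Suc m"
        using permutes_in_image[of \<sigma> "{..<Suc m}" m] that by simp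
      ultimately show "b (\<sigma> m) > 0"
        by (intro b_pos) simp
    qed (use that b0 in auto)
    then have "(\<Sum>\<sigma>\<in>?S. sign \<sigma> * mcoeff ((?p - var (\<sigma> m)) ^ (k + m) * ?M \<sigma>) b) =
        (\<Sum>\<sigma>\<in>?T. sign \<sigma> * mcoeff ((?p - var (\<sigma> m)) ^ (k + m) * ?M \<sigma>) b)"
      using sub by (intro sum.mono_neutral_right) (auto simp: finite_permutations)
    also have "\<dots> = (\<Sum>\<sigma>\<in>?T. sign \<sigma> * mcoeff (var_sum m ^ (k + m) * ?M \<sigma>) b)"
    proof (rule sum.cong[OF refl])
      fix \<sigma> assume "\<sigma> \<in> ?T"
      then have "\<sigma> m = m"
        by (auto intro: permutes_not_in)
      then show "sign \<sigma> * mcoeff ((?p - var (\<sigma> m)) ^ (k + m) * ?M \<sigma>) b =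
          sign \<sigma> * mcoeff (var_sum m ^ (k + m) * ?M \<sigma>) b"
        by (simp add: var_sum_def)
    qed
    also have "\<dots> = mcoeff (\<Sum>\<sigma>\<in>?T. of_int (sign \<sigma>) * (var_sum m ^ (k + m) * ?M \<sigma>)) b"
      by (simp only: mcoeff_sum mcoeff_of_int_mult)
    also have "(\<Sum>\<sigma>\<in>?T. of_int (sign \<sigma>) * (var_sum m ^ (k + m) * ?M \<sigma>)) =
        var_sum m ^ (k + m) * alternant m (staircase m)"
      unfolding alternant_def sum_distrib_left by (intro sum.cong refl mult.left_commute)
    also have "mcoeff (var_sum m ^ (k + m) * alternant m (staircase m)) b = int (num_SYT ?\<mu>)"
      unfolding b_eq psize'[symmetric]
    proof (rule num_SYT_eq_mcoeff[symmetric])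
      show "?\<mu> i = 0" if "i \<ge> m" for i
        using that by (rule supp')
      show "is_partition ?\<mu>"
        using partition_Suc_le[OF part] supp'
        by (intro is_partitionI[of _ m]) (auto simp: one_column_def intro: le_SucI)
    qed
    finally show ?thesis
      using True by simp
  qed
  finally show ?thesis
    unfolding b_def .
qed

section \<open>Assembly of the expansion over an arbitrary commutative ring\<close>

lemma schur_bar_one_row:
  fixes x :: "nat \<Rightarrow> 'b :: comm_ring_1"
  assumes "n > 0"
  shows "schur_bar n (one_row k) x =
    (\<Sum>\<mu> | is_partition \<mu> \<and> psize \<mu> = k \<and> plen \<mu> < n.
       of_nat (num_SYT (\<lambda>i. \<mu> i + one_column (n - 1) i)) * schur n \<mu> x)"
proof -
  obtain m where n: "n = Suc m"
    using assms by (cases n) auto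
  define W where "W r \<mu> = mcoeff (var_sum n ^ (k - r) *
      alternant n (\<lambda>i. one_row r i + staircase n i)) (\<lambda>i. \<mu> i + staircase n i)" for r \<mu>
  let ?a = "\<lambda>r. (- 1) ^ r * int ((k + m) choose (k - r))"
  let ?q = "\<Sum>j=1..n. x j"
  have pow: "?q ^ (k - r) * schur n (one_row r) x = (\<Sum>\<mu>\<in>partitions n k. of_int (W r \<mu>) * schur n \<mu> x)"
    if "r \<le> k" for r
    unfolding W_def pieri_power[OF assms, of x "k - r" r] using that by simp
  have "schur_bar n (one_row k) x = (\<Sum>r\<le>k. of_int (?a r) * (?q ^ (k - r) * schur n (one_row r) x))"
    unfolding schur_bar_def schur_one_row_shift by (intro sum.cong) (auto simp: n)
  also have "\<dots> = (\<Sum>r\<le>k. \<Sum>\<mu>\<in>partitions n k. of_int (?a r * W r \<mu>) * schur n \<mu> x)"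
  proof (rule sum.cong[OF refl])
    fix r assume "r \<in> {..k}"
    then have "r \<le> k"
      by simp
    then show "of_int (?a r) * (?q ^ (k - r) * schur n (one_row r) x) =
        (\<Sum>\<mu>\<in>partitions n k. of_int (?a r * W r \<mu>) * schur n \<mu> x)"
      unfolding pow[OF \<open>r \<le> k\<close>] sum_distrib_left by (simp add: mult.assoc)
  qed
  also have "\<dots> = (\<Sum>\<mu>\<in>partitions n k. of_int (\<Sum>r\<le>k. ?a r * W r \<mu>) * schur n \<mu> x)"
    by (subst sum.swap) (simp add: sum_distrib_right)
  also have "\<dots> = (\<Sum>\<mu>\<in>partitions n k. of_int (if \<mu> m = 0 then int (num_SYT (\<lambda>i. \<mu> i + one_column m i)) else 0)
      * schur n \<mu> x)"
    unfolding W_def n by (intro sum.cong refl) (simp only: sum_mcoeff_alternant)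
  also have "\<dots> = (\<Sum>\<mu>\<in>{\<mu> \<in> partitions n k. \<mu> m = 0}. of_nat (num_SYT (\<lambda>i. \<mu> i + one_column m i)) * schur n \<mu> x)"
    by (rule sum.mono_neutral_cong_right) (auto simp: finite_partitions_of)
  \<comment> \<open>With n = m+1, vanishing of row m together with all later rows means that fewer
    than n parts are nonzero.\<close>
  also have "{\<mu> \<in> partitions n k. \<mu> m = 0} = {\<mu>. is_partition \<mu> \<and> psize \<mu> = k \<and> plen \<mu> < n}"
  proof -
    have "(\<forall>i\<ge>Suc m. \<mu> i = 0) \<and> \<mu> m = 0 \<longleftrightarrow> (\<forall>i\<ge>m. \<mu> i = 0)" for \<mu> :: "nat \<Rightarrow> nat"
      by (metis Suc_leD Suc_leI le_neq_implies_less le_refl)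
    then show ?thesis
      by (auto simp: partitions_def n less_Suc_eq_le plen_le_iff)
  qed
  finally show ?thesis
    by (simp add: n)
qed

theorem theorem3p5:
  fixes k n :: nat
  assumes "k > 0" and "n > 0"
  shows "schur_bar n (one_row k) (indet :: nat \<Rightarrow> 'a::comm_ring_1 mpoly) =
    (\<Sum>\<mu> | is_partition \<mu> \<and> psize \<mu> = k \<and> plen \<mu> < n.
       of_nat (num_SYT (\<lambda>i. \<mu> i + one_column (n - 1) i)) * schur n \<mu> indet)"
  using assms(2) by (rule schur_bar_one_row)

end
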